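(* Let $A$ be a finite alphabet with at least two letters and let $\{\phi_i\}_{i\in A}$ be a conformal iterated function system (CIFS) on $Y$ with alphabet $A$. Then the extended Hausdorff dimension spectrum is maximal: $$\{HD(J(X)) \ :\ X\subset A^{\mathbb{N}} \text{ a subshift}\}=[0,HD(J(A^{\mathbb{N}}))],$$ where $J(A^{\mathbb{N}})$ is the limit set of the whole CIFS and $HD$ denotes Hausdorff dimension.
   Context: **Symbolic notation.** $A^{\mathbb{N}}$ is the set of sequences $x=(x_1,x_2,\ldots)$ with $x_i\in A$, with the product of the discrete topology. The left shift is $\sigma(x_1,x_2,\ldots)=(x_2,x_3,\ldots)$. A subshift over $A$ is a closed set $X\subset A^{\mathbb{N}}$ with $x\in X\Rightarrow\sigma x\in X$. **CIFS.** A conformal iterated function system with alphabet $A$ (with at least two letters) consists of a non-empty compact set $Y\subset\mathbb{R}^d$ ($d\ge1$) and one-to-one contractions $\phi_e:Y\to Y$, $e\in A$, whose contraction ratios are all at most some $s\in(0,1)$, such that: (i) $Y$ is connected and $Y=\overline{\mathrm{Int}_{\mathbb{R}^d}(Y)}$; (ii) (Open Set Condition) $\phi_e(\mathrm{Int}(Y))\cap\phi_f(\mathrm{Int}(Y))=\emptyset$ for all $e\neq f$ in $A$; (iii) for every $f\in A$ there is a connected open set $W_f$ with $Y\subseteq W_f\subseteq\mathbb{R}^d$ such that $\phi_f$ extends to a $C^1$ conformal diffeomorphism of $W_f$ into $\bigcap_{e\in A}W_e$; (iv) there are constants $L\ge1$, $\alpha>0$ such that $\bigl||\phi_e'(x)|-|\phi_e'(y)|\bigr|\le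 L\,\|(\phi_e')^{-1}\|^{-1}\,|x-y|^\alpha$ for all $e\in A$ and $x,y\in Y$, where $|\phi_e'(x)|$ is the norm of the derivative at $x$ and $\|(\phi_e')^{-1}\|$ is the supremum over $Y$ of the norm of the inverse of the derivative; (v) (Cone Property) there exist $\gamma,l>0$, $\gamma<\pi/2$, such that for every $x\in Y$ there is an open cone $\mathrm{Con}(x,\gamma,l)\subseteq\mathrm{Int}(Y)$ with vertex $x$, central angle $\gamma$ and altitude $l$. **Limit sets.** The coding map $\pi:A^{\mathbb{N}}\to Y$ is defined by $\{\pi(\omega)\}=\bigcap_{n\ge1}\phi_{\omega_1}\circ\cdots\circ\phi_{\omega_n}(Y)$ (the intersection is a singleton). For a subshift $X\subset A^{\mathbb{N}}$, its limit set is $J(X)=\pi(X)$; the limit set of the CIFS is $J(A^{\mathbb{N}})=\pi(A^{\mathbb{N}})$. *)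

theory Defs
  imports "HOL-Analysis.Analysis"
begin

section \<open>Hausdorff dimension\<close>

text \<open>The gauge is \<open>(diam U)\<^sup>s\<close> with the usual conventions that the empty set contributes \<open>0\<close>
  and that \<open>0\<^sup>0 = 1\<close> for nonempty \<open>U\<close> (in the library \<open>0 powr 0 = 0\<close>).\<close>

definition diam_gauge :: "real \<Rightarrow> 'a::metric_space set \<Rightarrow> ennreal" where
  "diam_gauge s U = (if U = {} then 0 else if s = 0 then 1 else ennreal (diameter U powr s))"

text \<open>Boundedness is required explicitly because \<open>diameter\<close> is only meaningful on bounded sets.
  Finite covers are included, since members of a cover may be empty.\<close>

definition delta_cover :: "real \<Rightarrow> 'a::metric_space set \<Rightarrow> (nat \<Rightarrow> 'a set) \<Rightarrow> bool" where
  "delta_cover \<delta> S U \<longleftrightarrow> (\<forall>i. bounded (U i) \<and> diameter (U i) \<le> \<delta>) \<and> S \<subseteq> (\<Union>i. U i)"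

definition hausdorff_premeasure :: "real \<Rightarrow> real \<Rightarrow> 'a::metric_space set \<Rightarrow> ennreal" where
  "hausdorff_premeasure s \<delta> S = (INF U\<in>{U. delta_cover \<delta> S U}. \<Sum>i. diam_gauge s (U i))"

definition hausdorff_measure :: "real \<Rightarrow> 'a::metric_space set \<Rightarrow> ennreal" where
  "hausdorff_measure s S = (SUP \<delta>\<in>{0<..}. hausdorff_premeasure s \<delta> S)"

definition hausdorff_dim :: "'a::metric_space set \<Rightarrow> ennreal" where
  "hausdorff_dim S = Inf {ennreal s |s. 0 \<le> s \<and> hausdorff_measure s S = 0}"

section \<open>Subshifts\<close>

text \<open>Sequences are indexed from \<open>0\<close>.\<close>

definition full_shift :: "'e set \<Rightarrow> (nat \<Rightarrow> 'e) set" where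
  "full_shift A = {x. \<forall>i. x i \<in> A}"

definition shift :: "(nat \<Rightarrow> 'e) \<Rightarrow> nat \<Rightarrow> 'e" where
  "shift x = (\<lambda>i. x (Suc i))"

text \<open>The topology below has underlying set \<^term>\<open>full_shift A\<close>, so \<^term>\<open>closedin\<close> includes
  \<open>X \<subseteq> full_shift A\<close>.\<close>

definition subshift :: "'e set \<Rightarrow> (nat \<Rightarrow> 'e) set \<Rightarrow> bool" where
  "subshift A X \<longleftrightarrow>
     closedin (product_topology (\<lambda>_. discrete_topology A) UNIV) X \<and> (\<forall>x\<in>X. shift x \<in> X)"

section \<open>Conformal iterated function systems\<close>

definition C1_on :: "'v::euclidean_space set \<Rightarrow> ('v \<Rightarrow> 'v) \<Rightarrow> bool" where
  "C1_on W f \<longleftrightarrow> (\<exists>f'::'v \<Rightarrow> 'v \<Rightarrow>\<^sub>L 'v.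
     (\<forall>x\<in>W. (f has_derivative blinfun_apply (f' x)) (at x)) \<and> continuous_on W f')"

text \<open>Conformality means that every derivative is a similarity; orientation reversal is allowed.\<close>

definition conformal_on :: "'v::euclidean_space set \<Rightarrow> ('v \<Rightarrow> 'v) \<Rightarrow> bool" where
  "conformal_on W f \<longleftrightarrow> (\<forall>x\<in>W. \<exists>c>0. \<exists>T. orthogonal_transformation T \<and>
     (f has_derivative (\<lambda>v. c *\<^sub>R T v)) (at x))"

definition C1_conformal_diffeo_into ::
    "'v::euclidean_space set \<Rightarrow> 'v set \<Rightarrow> ('v \<Rightarrow> 'v) \<Rightarrow> bool" where
  "C1_conformal_diffeo_into W V f \<longleftrightarrow>
     f ` W \<subseteq> V \<and> inj_on f W \<and> open (f ` W) \<and>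
     C1_on W f \<and> C1_on (f ` W) (inv_into W f) \<and> conformal_on W f"

text \<open>The open cone with vertex \<open>x\<close>, axis direction \<open>u\<close> (a unit vector), altitude \<open>l\<close> and
  angle \<open>\<gamma>\<close> between the axis and the lateral surface.\<close>

definition open_cone :: "'v::euclidean_space \<Rightarrow> 'v \<Rightarrow> real \<Rightarrow> real \<Rightarrow> 'v set" where
  "open_cone x u \<gamma> l = {y. cos \<gamma> * norm (y - x) < (y - x) \<bullet> u \<and> (y - x) \<bullet> u < l}"

text \<open>Only the values of \<open>\<phi> e\<close> on \<open>Y\<close> matter. The extension \<open>\<psi> e\<close> of \<open>\<phi> e\<close> to the neighbourhood
  \<open>W e\<close> gives a meaning to the derivative of \<open>\<phi> e\<close> at boundary points of \<open>Y\<close>; it does not depend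
  on the extension chosen, because \<open>Y\<close> is the closure of its interior and \<open>\<psi> e\<close> is \<open>C\<^sup>1\<close>.
  The quantity \<open>\<parallel>(\<phi> e')\<^sup>-\<^sup>1\<parallel>\<close> in the Hoelder condition is the supremum over \<open>Y\<close>.\<close>

locale cifs =
  fixes A :: "'e set" and Y :: "'v::euclidean_space set" and \<phi> :: "'e \<Rightarrow> 'v \<Rightarrow> 'v"
  assumes two_letters: "\<exists>e\<in>A. \<exists>f\<in>A. e \<noteq> f"
    and nonempty: "Y \<noteq> {}"
    and compact: "compact Y"
    and maps_to: "\<And>e. e \<in> A \<Longrightarrow> \<phi> e ` Y \<subseteq> Y"
    and injective: "\<And>e. e \<in> A \<Longrightarrow> inj_on (\<phi> e) Y"
    and contraction: "\<exists>s. 0 < s \<and> s < 1 \<and> (\<forall>e\<in>A. s-lipschitz_on Y (\<phi> e))"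
    and connected: "connected Y"
    and regular_closed: "Y = closure (interior Y)"
    and open_set_condition:
      "\<And>e f. e \<in> A \<Longrightarrow> f \<in> A \<Longrightarrow> e \<noteq> f \<Longrightarrow> \<phi> e ` interior Y \<inter> \<phi> f ` interior Y = {}"
    and conformal_extension:
      "\<exists>W \<psi>.
         (\<forall>e\<in>A. open (W e) \<and> connected (W e) \<and> Y \<subseteq> W e \<and>
            (\<forall>x\<in>Y. \<psi> e x = \<phi> e x) \<and>
            C1_conformal_diffeo_into (W e) (\<Inter>f\<in>A. W f) (\<psi> e)) \<and>
         (\<exists>L\<ge>1. \<exists>\<alpha>>0. \<forall>e\<in>A. \<forall>x\<in>Y. \<forall>y\<in>Y.
            \<bar>onorm (frechet_derivative (\<psi> e) (at x)) - onorm (frechet_derivative (\<psi> e) (at y))\<bar>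
            \<le> L * inverse (SUP z\<in>Y. onorm (inv (frechet_derivative (\<psi> e) (at z))))
                * norm (x - y) powr \<alpha>)"
    and cone_property:
      "\<exists>\<gamma>>0. \<exists>l>0. \<gamma> < pi / 2 \<and>
         (\<forall>x\<in>Y. \<exists>u. norm u = 1 \<and> open_cone x u \<gamma> l \<subseteq> interior Y)"

section \<open>Limit sets\<close>

text \<open>\<open>word_map \<phi> \<omega> n\<close> is \<open>\<phi>\<^bsub>\<omega> 0\<^esub> \<circ> \<dots> \<circ> \<phi>\<^bsub>\<omega> (n - 1)\<^esub>\<close>.\<close>

primrec word_map :: "('e \<Rightarrow> 'v \<Rightarrow> 'v) \<Rightarrow> (nat \<Rightarrow> 'e) \<Rightarrow> nat \<Rightarrow> 'v \<Rightarrow> 'v" where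
  "word_map \<phi> \<omega> 0 = id"
| "word_map \<phi> \<omega> (Suc n) = word_map \<phi> \<omega> n \<circ> \<phi> (\<omega> n)"

definition coding_map :: "('e \<Rightarrow> 'v \<Rightarrow> 'v) \<Rightarrow> 'v set \<Rightarrow> (nat \<Rightarrow> 'e) \<Rightarrow> 'v" where
  "coding_map \<phi> Y \<omega> = the_elem (\<Inter>n\<in>{1..}. word_map \<phi> \<omega> n ` Y)"

definition limit_set :: "('e \<Rightarrow> 'v \<Rightarrow> 'v) \<Rightarrow> 'v set \<Rightarrow> (nat \<Rightarrow> 'e) set \<Rightarrow> 'v set" where
  "limit_set \<phi> Y X = coding_map \<phi> Y ` X"

end

theory Submission
  imports Defs
begin

text \<open>
  Bounded distortion on \<open>Y\<close> gives every word \<open>w\<close> a weight \<open>r w\<close>, comparable to the derivative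
  of \<open>\<phi>\<^sub>w\<close> everywhere and multiplicative up to a constant. By Furstenberg's argument,
  \<open>HD(J(X)) < t\<close> forces a finite set \<open>W\<close> of words with \<open>\<Sum>w\<in>W. r w powr t < 1\<close> such that every
  point of \<open>X\<close> has a prefix in \<open>W\<close>; conversely such a \<open>W\<close> gives \<open>HD(J(X)) \<le> t\<close>. This criterion
  makes the dimension right-continuous along the increasing family of subshifts
  \<open>X\<^sub>c = {x. \<forall>n. val (\<sigma>\<^sup>n x) \<le> c}\<close>, where \<open>val\<close> is a positional expansion. Left-continuity holds
  because, up to copies of its largest sequence \<open>\<theta>\<close>, \<open>X\<^sub>c\<close> is generated by a prefix code, as for
  beta-shifts, and finite parts of the code already live in \<open>X\<^sub>c\<^sub>'\<close> for some \<open>c' < c\<close>. So, for \<open>t\<close>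
  below the full dimension, \<open>X\<^sub>c\<close> with \<open>c = Sup {c. HD(J(X\<^sub>c)) \<le> t}\<close> has dimension exactly \<open>t\<close>.
\<close>

text \<open>The weights are multiplicative only up to constants, while the covering criterion asks
  for a total strictly below 1, so every constant has to be beaten. Two devices do this:
  concatenating the words of a cover n times makes a total below 1 geometrically small, and raising
  the exponent by a fixed amount gains a factor exponentially small in the word length. The delicate
  point is left-continuity, where the bound on the code words must not depend on the level
  \<open>c' < c\<close> in whose language they live. Furstenberg's parsing only yields some bound
  depending on \<open>c'\<close>. But the code is prefix-free, so the totals over its powers are
  almost supermultiplicative, and a bounded sequence of this kind is bounded by the reciprocal of
  its constant. On the geometric side the obstacle is that \<open>Y\<close> need not be convex:
  derivative bounds turn into distance bounds only along segments inside \<open>Y\<close>.\<close>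

lemma sum_le_sum_image_superset:
  fixes f :: "'a \<Rightarrow> real"
  assumes "finite I" and "S \<subseteq> g ` I" and "\<And>i. i \<in> I \<Longrightarrow> 0 \<le> f (g i)"
  shows "sum f S \<le> (\<Sum>i\<in>I. f (g i))"
proof -
  have "sum f S \<le> sum f (g ` I)"
    by (rule sum_mono2) (use assms in auto)
  also have "\<dots> \<le> sum (f \<circ> g) I"
    by (rule sum_image_le) (use assms in auto)
  finally show ?thesis
    by (simp add: o_def)
qed

text \<open>If \<open>Q * a n\<close> exceeded 1, its powers, which stay below
  \<open>Q * a (n * Suc m)\<close>, would outgrow \<open>Q * B\<close>. The value of
  \<open>B\<close> disappears from the conclusion; this is what makes a bound of unknown size
  usable.\<close>

lemma supermultiplicative_bounded:
  fixes a :: "nat \<Rightarrow> real"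
  assumes super: "\<And>m n. Q * (a m * a n) \<le> a (m + n)"
    and bound: "\<And>n. a n \<le> B" and Q: "0 < Q" and nonneg: "\<And>n. 0 \<le> a n"
  shows "Q * a n \<le> 1"
proof (rule ccontr)
  assume "\<not> Q * a n \<le> 1"
  then have gt: "1 < Q * a n"
    by simp
  have pow: "(Q * a n) ^ Suc m \<le> Q * a (n * Suc m)" for m
  proof (induction m)
    case (Suc m)
    have "(Q * a n) ^ Suc (Suc m) = (Q * a n) * (Q * a n) ^ Suc m"
      by simp
    also have "\<dots> \<le> (Q * a n) * (Q * a (n * Suc m))"
      using Suc Q nonneg by (intro mult_left_mono) auto
    also have "\<dots> = Q * (Q * (a n * a (n * Suc m)))"
      by (simp add: algebra_simps)
    also have "\<dots> \<le> Q * a (n + n * Suc m)"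
      using super[of n "n * Suc m"] Q by (intro mult_left_mono) auto
    finally show ?case
      by (simp add: algebra_simps)
  qed auto
  obtain m where m: "Q * B < (Q * a n) ^ m"
    using real_arch_pow[OF gt] by blast
  also have "\<dots> \<le> (Q * a n) ^ Suc m"
    using gt by (intro power_increasing) auto
  also have "\<dots> \<le> Q * a (n * Suc m)"
    by (rule pow)
  also have "\<dots> \<le> Q * B"
    using bound Q by (intro mult_left_mono) auto
  finally show False
    by simp
qed

section \<open>Words and subshifts\<close>

definition pref :: "(nat \<Rightarrow> 'e) \<Rightarrow> nat \<Rightarrow> 'e list" where
  "pref x n = map x [0..<n]"

lemma length_pref [simp]: "length (pref x n) = n"
  by (simp add: pref_def)

lemma pref_0 [simp]: "pref x 0 = []"
  by (simp add: pref_def)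

lemma pref_Suc: "pref x (Suc n) = pref x n @ [x n]"
  by (simp add: pref_def)

lemma funpow_shift: "(shift ^^ m) x = (\<lambda>i. x (i + m))"
  by (induction m) (auto simp: shift_def)

lemma pref_add: "pref x (m + n) = pref x m @ pref ((shift ^^ m) x) n"
  by (induction n) (auto simp: pref_Suc funpow_shift add.commute)

lemma pref_Suc_Cons: "pref x (Suc n) = x 0 # pref (shift x) n"
  using pref_add[of x 1 n] by (simp add: pref_Suc)

lemma pref_eq_iff: "pref x n = pref y n \<longleftrightarrow> (\<forall>i<n. x i = y i)"
  by (auto simp: pref_def)

lemma pref_in_lists [simp]: "x \<in> full_shift A \<Longrightarrow> pref x n \<in> lists A"
  by (auto simp: pref_def full_shift_def)

lemma funpow_shift_in_full [simp]: "x \<in> full_shift A \<Longrightarrow> (shift ^^ n) x \<in> full_shift A"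
  by (auto simp: funpow_shift full_shift_def)

lemma shift_in_full [simp]: "x \<in> full_shift A \<Longrightarrow> shift x \<in> full_shift A"
  by (auto simp: shift_def full_shift_def)

section \<open>The product topology on sequences, seen through cylinders\<close>

abbreviation seq_topology :: "'e set \<Rightarrow> (nat \<Rightarrow> 'e) topology" where
  "seq_topology A \<equiv> product_topology (\<lambda>_. discrete_topology A) UNIV"

lemma topspace_seq_topology [simp]: "topspace (seq_topology A) = full_shift A"
  by (auto simp: full_shift_def PiE_def)

lemma openin_cylinder: "openin (seq_topology A) {y \<in> full_shift A. pref y n = w}"
proof (induction n arbitrary: w)
  case 0
  show ?case
    using openin_topspace[of "seq_topology A"]
    unfolding topspace_seq_topology by (cases "w = []") auto
next
  case (Suc n)
  show ?case
  proof (cases w rule: rev_cases)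
    case Nil
    then show ?thesis
      by (simp add: pref_Suc)
  next
    case (snoc v a)
    have "openin (seq_topology A) {y \<in> topspace (seq_topology A). y n \<in> {a} \<inter> A}"
      by (rule openin_continuous_map_preimage[OF continuous_map_product_projection]) auto
    moreover have "{y \<in> full_shift A. pref y (Suc n) = w} =
        {y \<in> full_shift A. pref y n = v} \<inter> {y \<in> topspace (seq_topology A). y n \<in> {a} \<inter> A}"
      unfolding topspace_seq_topology
      by (auto simp: snoc pref_Suc full_shift_def)
    ultimately show ?thesis
      using Suc.IH[of v] by (simp only: openin_Int)
  qed
qed

lemma openin_seq_topologyI:
  assumes "U \<subseteq> full_shift A"
    and "\<And>x. x \<in> U \<Longrightarrow> \<exists>n. \<forall>y\<in>full_shift A. pref y n = pref x n \<longrightarrow> y \<in> U"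
  shows "openin (seq_topology A) U"
proof (subst openin_subopen, intro ballI)
  fix x assume x: "x \<in> U"
  then obtain n where "\<forall>y\<in>full_shift A. pref y n = pref x n \<longrightarrow> y \<in> U"
    using assms(2) by blast
  then show "\<exists>T. openin (seq_topology A) T \<and> x \<in> T \<and> T \<subseteq> U"
    using openin_cylinder[of A n "pref x n"] x assms(1)
    by (intro exI[of _ "{y \<in> full_shift A. pref y n = pref x n}"]) auto
qed

lemma compact_space_seq_topology: "finite A \<Longrightarrow> compact_space (seq_topology A)"
  by (simp add: compact_space_product_topology compact_space_discrete_topology)

lemma subshift_subset: "subshift A X \<Longrightarrow> X \<subseteq> full_shift A"
  unfolding subshift_def by (metis closedin_subset topspace_seq_topology)

lemma subshift_shift: "subshift A X \<Longrightarrow> x \<in> X \<Longrightarrow> (shift ^^ n) x \<in> X"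
  by (induction n) (auto simp: subshift_def)

lemma subshift_empty: "subshift A {}"
  by (simp add: subshift_def)

lemma subshift_full: "subshift A (full_shift A)"
  unfolding subshift_def
  using closedin_topspace[of "seq_topology A", unfolded topspace_seq_topology] by simp

section \<open>Covering sets of words and their concatenation powers\<close>

definition covered_by :: "(nat \<Rightarrow> 'e) set \<Rightarrow> 'e list set \<Rightarrow> bool" where
  "covered_by X W \<longleftrightarrow> (\<forall>x\<in>X. \<exists>n. pref x n \<in> W)"

lemma openin_prefix_in: "openin (seq_topology A) {x \<in> full_shift A. \<exists>n. pref x n \<in> W}"
  by (rule openin_seq_topologyI) (auto, metis)

primrec wpow :: "'e list set \<Rightarrow> nat \<Rightarrow> 'e list set" where
  "wpow W 0 = {[]}"
| "wpow W (Suc n) = (\<lambda>(u, v). u @ v) ` (W \<times> wpow W n)"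

lemma wpow_lists: "W \<subseteq> lists A \<Longrightarrow> wpow W n \<subseteq> lists A"
proof (induction n)
  case (Suc n)
  then show ?case
    by (auto simp: subset_iff in_lists_conv_set)
qed auto

lemma finite_wpow: "finite W \<Longrightarrow> finite (wpow W n)"
  by (induction n) auto

lemma length_wpow: "[] \<notin> W \<Longrightarrow> w \<in> wpow W n \<Longrightarrow> n \<le> length w"
proof (induction n arbitrary: w)
  case (Suc n)
  then obtain u v where "u \<in> W" "v \<in> wpow W n" "w = u @ v"
    by auto
  moreover from this Suc.prems have "length u \<ge> 1"
    by (cases u) auto
  ultimately show ?case
    using Suc.IH[of v] Suc.prems by auto
qed auto

lemma wpow_add: "wpow W (m + n) = (\<lambda>(u, v). u @ v) ` (wpow W m \<times> wpow W n)"
proof (induction m)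
  case (Suc m)
  show ?case
  proof (intro equalityI subsetI)
    fix w assume "w \<in> wpow W (Suc m + n)"
    then obtain a b c where "a \<in> W" "b \<in> wpow W m" "c \<in> wpow W n" "w = a @ b @ c"
      using Suc by auto
    then show "w \<in> (\<lambda>(u, v). u @ v) ` (wpow W (Suc m) \<times> wpow W n)"
      by (intro image_eqI[of _ _ "(a @ b, c)"]) auto
  next
    fix w assume "w \<in> (\<lambda>(u, v). u @ v) ` (wpow W (Suc m) \<times> wpow W n)"
    then obtain a b c where "a \<in> W" "b \<in> wpow W m" "c \<in> wpow W n" "w = a @ b @ c"
      by auto
    moreover from this have "b @ c \<in> wpow W (m + n)"
      using Suc by auto
    ultimately show "w \<in> wpow W (Suc m + n)"
      by auto
  qed
qed (force simp: image_iff)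

lemma covered_by_wpow:
  assumes "covered_by X W" and "\<And>x n. x \<in> X \<Longrightarrow> (shift ^^ n) x \<in> X"
  shows "covered_by X (wpow W n)"
  unfolding covered_by_def
proof
  fix x assume "x \<in> X"
  then show "\<exists>m. pref x m \<in> wpow W n"
  proof (induction n arbitrary: x)
    case 0
    then show ?case
      by (intro exI[of _ 0]) auto
  next
    case (Suc n)
    then obtain l where l: "pref x l \<in> W"
      using assms(1) by (auto simp: covered_by_def)
    obtain m where "pref ((shift ^^ l) x) m \<in> wpow W n"
      using Suc assms(2) by blast
    with l show ?case
      by (intro exI[of _ "l + m"]) (auto simp: pref_add)
  qed
qed

text \<open>Two words are comparable in the prefix order exactly when they have a common extension;
  in this form products are handled by cancelling the left factor.\<close>

definition prefix_free :: "'e list set \<Rightarrow> bool" where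
  "prefix_free W \<longleftrightarrow> (\<forall>u\<in>W. \<forall>v\<in>W. \<forall>p q. u @ p = v @ q \<longrightarrow> u = v)"

lemma prefix_free_wpow: "prefix_free W \<Longrightarrow> prefix_free (wpow W n)"
proof (induction n)
  case 0
  show ?case
    by (simp add: prefix_free_def)
next
  case (Suc n)
  then have W: "prefix_free W" and V: "prefix_free (wpow W n)"
    by auto
  show ?case
    unfolding prefix_free_def
  proof (intro ballI allI impI)
    fix u v p q
    assume "u \<in> wpow W (Suc n)" "v \<in> wpow W (Suc n)" and eq: "u @ p = v @ q"
    then obtain a b c d where 1: "a \<in> W" "c \<in> W" "b \<in> wpow W n" "d \<in> wpow W n"
      "u = a @ b" "v = c @ d"
      by auto
    with eq have "a @ (b @ p) = c @ (d @ q)"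
      by simp
    with W 1 have "a = c"
      unfolding prefix_free_def by blast
    moreover from this eq 1 have "b @ p = d @ q"
      by simp
    with V 1 have "b = d"
      unfolding prefix_free_def by blast
    ultimately show "u = v"
      using 1 by simp
  qed
qed

lemma inj_on_append_prefix_free:
  "prefix_free U \<Longrightarrow> inj_on (\<lambda>(u, v). u @ v) (U \<times> V)"
  unfolding prefix_free_def inj_on_def by force

section \<open>Almost multiplicative weights on words\<close>

text \<open>The empty word is not normalised to weight 1: submultiplicativity gives
  \<open>1 \<le> r []\<close>, and in the application \<open>r []\<close> is the distortion
  constant. Hence the factors \<open>r [] powr t\<close>.\<close>

locale word_weights =
  fixes A :: "'e set" and r :: "'e list \<Rightarrow> real" and K q s :: real
  assumes finite_A: "finite A" and A_nonempty: "A \<noteq> {}"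
    and K_pos: "0 < K" and q_pos: "0 < q" and s: "0 < s" "s < 1"
    and r_pos: "\<And>w. w \<in> lists A \<Longrightarrow> 0 < r w"
    and r_append_le: "\<And>u v. u \<in> lists A \<Longrightarrow> v \<in> lists A \<Longrightarrow> r (u @ v) \<le> r u * r v"
    and r_append_ge: "\<And>u v. u \<in> lists A \<Longrightarrow> v \<in> lists A \<Longrightarrow> q * (r u * r v) \<le> r (u @ v)"
    and r_decay: "\<And>w. w \<in> lists A \<Longrightarrow> r w \<le> K * s ^ length w"
begin

abbreviation weight :: "real \<Rightarrow> 'e list set \<Rightarrow> real" where
  "weight t W \<equiv> (\<Sum>w\<in>W. r w powr t)"

lemma weight_nonneg: "0 \<le> weight t W"
  by (simp add: sum_nonneg)

lemma weight_product_le: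
  assumes "finite U" "finite V" "U \<subseteq> lists A" "V \<subseteq> lists A" "0 < t"
    and "W \<subseteq> (\<lambda>(u, v). u @ v) ` (U \<times> V)"
  shows "weight t W \<le> weight t U * weight t V"
proof -
  have "weight t W \<le> (\<Sum>p\<in>U \<times> V. r ((\<lambda>(u, v). u @ v) p) powr t)"
    by (rule sum_le_sum_image_superset) (use assms in auto)
  also have "\<dots> \<le> (\<Sum>(u, v)\<in>U \<times> V. r u powr t * r v powr t)"
  proof (rule sum_mono)
    fix p assume "p \<in> U \<times> V"
    then obtain u v where p: "p = (u, v)" and uv: "u \<in> lists A" "v \<in> lists A"
      using assms(3,4) by (cases p) blast
    then show "r ((\<lambda>(u, v). u @ v) p) powr t \<le> (case p of (u, v) \<Rightarrow> r u powr t * r v powr t)"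
      using r_append_le[OF uv] r_pos[OF uv(1)] r_pos[OF uv(2)] r_pos[of "u @ v"] assms(5)
      by (auto simp flip: powr_mult intro!: powr_mono2)
  qed
  also have "\<dots> = weight t U * weight t V"
    by (simp add: sum_product sum.cartesian_product)
  finally show ?thesis .
qed

lemma weight_wpow_le:
  assumes "finite W" "W \<subseteq> lists A" "0 < t"
  shows "weight t (wpow W n) \<le> r [] powr t * weight t W ^ n"
proof (induction n)
  case (Suc n)
  have "weight t (wpow W (Suc n)) \<le> weight t W * weight t (wpow W n)"
    by (rule weight_product_le)
      (use assms finite_wpow[OF assms(1)] wpow_lists[OF assms(2)] in simp_all)
  also have "\<dots> \<le> weight t W * (r [] powr t * weight t W ^ n)"
    by (intro mult_left_mono Suc weight_nonneg)
  finally show ?case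
    by (simp add: algebra_simps)
qed auto

lemma weight_wpow_add_ge:
  assumes "finite W" "W \<subseteq> lists A" "0 < t" "prefix_free W"
  shows "q powr t * (weight t (wpow W m) * weight t (wpow W n)) \<le> weight t (wpow W (m + n))"
proof -
  let ?I = "wpow W m \<times> wpow W n"
  have "q powr t * (weight t (wpow W m) * weight t (wpow W n))
      = (\<Sum>p\<in>?I. q powr t * (r (fst p) powr t * r (snd p) powr t))"
    by (subst sum_product) (simp only: sum.cartesian_product sum_distrib_left case_prod_beta)
  also have "\<dots> \<le> (\<Sum>p\<in>?I. r (fst p @ snd p) powr t)"
  proof (rule sum_mono)
    fix p assume "p \<in> ?I"
    then have uv: "fst p \<in> lists A" "snd p \<in> lists A"
      using subsetD[OF wpow_lists[OF assms(2), of m]] subsetD[OF wpow_lists[OF assms(2), of n]]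
      by (simp_all only: mem_Times_iff)
    show "q powr t * (r (fst p) powr t * r (snd p) powr t) \<le> r (fst p @ snd p) powr t"
      using r_append_ge[OF uv] r_pos[OF uv(1)] r_pos[OF uv(2)] q_pos assms(3)
      by (auto simp flip: powr_mult intro!: powr_mono2)
  qed
  also have "\<dots> = weight t (wpow W (m + n))"
    \<comment> \<open>Unique parsing: a prefix-free left factor makes concatenation injective, so no
      weight is lost to coincidences.\<close>
    unfolding wpow_add
    by (subst sum.reindex[OF inj_on_append_prefix_free[OF prefix_free_wpow[OF assms(4)]]])
       (simp add: case_prod_beta)
  finally show ?thesis .
qed

text \<open>A word of length at least n weighs at most \<open>K * s ^ n\<close>, so the extra
  exponent \<open>t' - t\<close> pays off exponentially in n.\<close>

lemma weight_exponent_le: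
  assumes "t \<le> t'" "W \<subseteq> lists A" "\<And>w. w \<in> W \<Longrightarrow> n \<le> length w"
  shows "weight t' W \<le> (K * s ^ n) powr (t' - t) * weight t W"
proof -
  have "weight t' W \<le> (\<Sum>w\<in>W. (K * s ^ n) powr (t' - t) * r w powr t)"
  proof (rule sum_mono)
    fix w assume w: "w \<in> W"
    then have wA: "w \<in> lists A"
      using assms by auto
    have "r w \<le> K * s ^ length w"
      by (rule r_decay[OF wA])
    also have "\<dots> \<le> K * s ^ n"
      using assms(3)[OF w] s K_pos by (intro mult_left_mono power_decreasing) auto
    finally have le: "r w powr (t' - t) \<le> (K * s ^ n) powr (t' - t)"
      using assms(1) r_pos[OF wA] by (intro powr_mono2) auto
    have "r w powr t' = r w powr (t' - t) * r w powr t"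
      by (simp flip: powr_add)
    also have "\<dots> \<le> (K * s ^ n) powr (t' - t) * r w powr t"
      by (intro mult_right_mono le) auto
    finally show "r w powr t' \<le> (K * s ^ n) powr (t' - t) * r w powr t" .
  qed
  then show ?thesis
    by (simp add: sum_distrib_left)
qed

text \<open>Furstenberg's parsing argument: every word of the language of \<open>X\<close> is a concatenation of
  words of \<open>W\<close> followed by a remainder of bounded length.\<close>

lemma weight_language_bounded:
  assumes W: "finite W" "W \<subseteq> lists A" "[] \<notin> W" "weight t W < 1" "0 < t"
    and X: "covered_by X W" "X \<subseteq> full_shift A" "\<And>x n. x \<in> X \<Longrightarrow> (shift ^^ n) x \<in> X"
  obtains B where "\<And>G. finite G \<Longrightarrow> (\<And>g. g \<in> G \<Longrightarrow> \<exists>x\<in>X. \<exists>n. g = pref x n) \<Longrightarrow> weight t G \<le> B"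
proof -
  \<comment> \<open>A remainder is a proper prefix of some word of \<open>W\<close>, hence at most
    \<open>M\<close> long; the inserted 0 keeps \<open>Max\<close> defined when \<open>W\<close> is
    empty.\<close>
  define M where "M = Max (insert 0 (length ` W))"
  define U where "U = {u. set u \<subseteq> A \<and> length u \<le> M}"
  have finU: "finite U"
    unfolding U_def using finite_A by (rule finite_lists_length_le)
  have U: "U \<subseteq> lists A"
    by (auto simp: U_def)
  have M: "length w \<le> M" if "w \<in> W" for w
    unfolding M_def using that W(1) by (intro Max_ge) auto
  have parse: "\<exists>j\<le>n. \<exists>v\<in>wpow W j. \<exists>u\<in>U. pref x n = v @ u" if "x \<in> X" for x n
    using that
  proof (induction n arbitrary: x rule: less_induct)
    case (less n)
    obtain l where l: "pref x l \<in> W"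
      using X(1) less.prems by (auto simp: covered_by_def)
    have l0: "0 < l"
      using l W(3) by (cases l) auto
    show ?case
    proof (cases "l \<le> n")
      case True
      have "\<exists>j\<le>n - l. \<exists>v\<in>wpow W j. \<exists>u\<in>U. pref ((shift ^^ l) x) (n - l) = v @ u"
        by (rule less.IH) (use True l0 X(3) less.prems in auto)
      then obtain j v u where "j \<le> n - l" "v \<in> wpow W j" "u \<in> U"
        "pref ((shift ^^ l) x) (n - l) = v @ u"
        by blast
      then show ?thesis
        using True l l0 pref_add[of x l "n - l"]
        by (intro exI[of _ "Suc j"] conjI bexI[of _ "pref x l @ v"] bexI[of _ u]) auto
    next
      case False
      then have "pref x n \<in> U"
        using M[OF l] subsetD[OF X(2) less.prems] by (auto simp: U_def pref_def full_shift_def)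
      then show ?thesis
        by (intro exI[of _ 0]) auto
    qed
  qed
  \<comment> \<open>The weight of all remainders times the geometric series that bounds the weights
    of the powers of \<open>W\<close>.\<close>
  define B where "B = r [] powr t * weight t U / (1 - weight t W)"
  show thesis
  proof (rule that)
    fix G assume G: "finite G" "\<And>g. g \<in> G \<Longrightarrow> \<exists>x\<in>X. \<exists>n. g = pref x n"
    \<comment> \<open>The words of \<open>W\<close> are nonempty, so a word of length n parses into
      at most n of them; fewer than \<open>J\<close> factors suffice for all of
      \<open>G\<close>.\<close>
    define J where "J = Suc (Max (insert 0 (length ` G)))"
    define P where "P j = (\<lambda>(u, v). u @ v) ` (wpow W j \<times> U)" for j
    have finP: "finite (P j)" for j
      unfolding P_def using finU finite_wpow[OF W(1)] by auto
    have sub: "G \<subseteq> snd ` (SIGMA j:{..<J}. P j)"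
    proof
      fix g assume g: "g \<in> G"
      then obtain x n where x: "x \<in> X" and gx: "g = pref x n"
        using G(2) by blast
      obtain j v u where j: "j \<le> n" "v \<in> wpow W j" "u \<in> U" "pref x n = v @ u"
        using parse[OF x] by blast
      have "n \<le> Max (insert 0 (length ` G))"
        using g gx G(1) by (intro Max_ge) (auto intro: rev_image_eqI)
      then show "g \<in> snd ` (SIGMA j:{..<J}. P j)"
        using j gx by (intro image_eqI[of _ _ "(j, g)"]) (auto simp: J_def P_def)
    qed
    have "weight t G \<le> (\<Sum>p\<in>(SIGMA j:{..<J}. P j). r (snd p) powr t)"
      by (rule sum_le_sum_image_superset[OF _ sub]) (use finP in auto)
    also have "\<dots> = (\<Sum>j<J. weight t (P j))"
      by (subst sum.Sigma) (use finP in \<open>auto simp: case_prod_beta\<close>)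
    also have "\<dots> \<le> (\<Sum>j<J. r [] powr t * weight t U * weight t W ^ j)"
    proof (rule sum_mono)
      fix j
      have "weight t (P j) \<le> weight t (wpow W j) * weight t U"
        unfolding P_def using finU finite_wpow[OF W(1)] wpow_lists[OF W(2)] U W(5)
        by (intro weight_product_le) auto
      also have "\<dots> \<le> (r [] powr t * weight t W ^ j) * weight t U"
        by (intro mult_right_mono weight_wpow_le W weight_nonneg)
      finally show "weight t (P j) \<le> r [] powr t * weight t U * weight t W ^ j"
        by (simp add: algebra_simps)
    qed
    also have "\<dots> = r [] powr t * weight t U * (\<Sum>j<J. weight t W ^ j)"
      by (simp add: sum_distrib_left)
    also have "\<dots> \<le> r [] powr t * weight t U * (1 / (1 - weight t W))"
    proof (rule mult_left_mono)
      have "(\<Sum>j<J. weight t W ^ j) = (1 - weight t W ^ J) / (1 - weight t W)"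
        using W(4) by (simp add: sum_gp_strict)
      also have "\<dots> \<le> 1 / (1 - weight t W)"
        using W(4) weight_nonneg[of t W] by (intro divide_right_mono) auto
      finally show "(\<Sum>j<J. weight t W ^ j) \<le> 1 / (1 - weight t W)" .
    qed (simp add: weight_nonneg)
    finally show "weight t G \<le> B"
      by (simp add: B_def)
  qed
qed

end

section \<open>The dimension spectrum of an abstract dimension function\<close>

lemma geometric_limit_eq:
  fixes x :: real
  assumes "0 < x"
  shows "(x - 1) / (x + 1) * (1 / (1 - 1 / (x + 1))) = (x - 1) / x"
proof -
  have "1 - 1 / (x + 1) = x / (x + 1)"
    using assms by (simp add: field_simps)
  then show ?thesis
    using assms by simp
qed

lemma digit_sum_carry:
  fixes x :: real
  assumes "0 < x"
  shows "(a + (x - 1) / x) / (x + 1) + 1 / x / (x + 1) = (a + 1) / (x + 1)"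
proof -
  have "a + (x - 1) / x + 1 / x = a + 1"
    using assms by (simp add: field_simps)
  then show ?thesis
    by (metis add_divide_distrib)
qed

text \<open>The hypotheses \<open>dim_less_imp_cover\<close> and \<open>cover_imp_dim_le\<close> say that \<open>D\<close> is the critical
  exponent of the weights; for Hausdorff dimension the former is Furstenberg's theorem.\<close>

locale subshift_dimension = word_weights A r K q s
  for A :: "'e set" and r K q s +
  fixes D :: "(nat \<Rightarrow> 'e) set \<Rightarrow> ennreal" and idx :: "'e \<Rightarrow> nat"
  assumes idx: "bij_betw idx A {..<card A}"
    and dim_empty: "D {} = 0"
    and dim_mono: "\<And>X X'. X \<subseteq> X' \<Longrightarrow> X' \<subseteq> full_shift A \<Longrightarrow> D X \<le> D X'"
    and dim_less_imp_cover: "\<And>X t. subshift A X \<Longrightarrow> 0 < t \<Longrightarrow> D X < ennreal t \<Longrightarrow>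
      \<exists>W. finite W \<and> W \<subseteq> lists A \<and> [] \<notin> W \<and> covered_by X W \<and> weight t W < 1"
    and cover_imp_dim_le: "\<And>X W t. subshift A X \<Longrightarrow> 0 < t \<Longrightarrow> finite W \<Longrightarrow> W \<subseteq> lists A \<Longrightarrow>
      [] \<notin> W \<Longrightarrow> covered_by X W \<Longrightarrow> weight t W < 1 \<Longrightarrow> D X \<le> ennreal t"
begin

abbreviation m :: real where "m \<equiv> real (card A)"

lemma m_ge_1: "1 \<le> m"
  using finite_A A_nonempty by (simp add: Suc_leI card_gt_0_iff)

lemma idx_le: "a \<in> A \<Longrightarrow> real (idx a) \<le> m - 1"
proof -
  assume "a \<in> A"
  then have "idx a < card A"
    using idx by (auto simp: bij_betw_def)
  then show ?thesis
    by (simp add: of_nat_diff Suc_leI flip: of_nat_Suc)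
qed

text \<open>Since the base exceeds the number of digits by one, expansions are unique, and \<open>val\<close> is
  strictly increasing for the lexicographic order.\<close>

definition val :: "(nat \<Rightarrow> 'e) \<Rightarrow> real" where
  "val x = (\<Sum>i. real (idx (x i)) * (1 / (m + 1)) ^ Suc i)"

lemma max_digit_sums: "(\<lambda>i. (m - 1) * (1 / (m + 1)) ^ Suc i) sums ((m - 1) / m)"
proof -
  have "(\<lambda>i. (1 / (m + 1)) ^ i) sums (1 / (1 - 1 / (m + 1)))"
    using m_ge_1 by (intro geometric_sums) (auto simp: field_simps)
  from sums_mult[OF this, of "(m - 1) / (m + 1)"]
  have "(\<lambda>i. (m - 1) / (m + 1) * (1 / (m + 1)) ^ i) sums ((m - 1) / (m + 1) * (1 / (1 - 1 / (m + 1))))" .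
  moreover have "(m - 1) / (m + 1) * (1 / (1 - 1 / (m + 1))) = (m - 1) / m"
    using geometric_limit_eq[of m] m_ge_1 by simp
  ultimately show ?thesis
    by (simp add: field_simps)
qed

lemma summable_val:
  assumes "x \<in> full_shift A"
  shows "summable (\<lambda>i. real (idx (x i)) * (1 / (m + 1)) ^ Suc i)"
proof (rule summable_comparison_test'[OF sums_summable[OF max_digit_sums], of 0])
  fix i :: nat
  have "x i \<in> A"
    using assms by (simp add: full_shift_def)
  then have "real (idx (x i)) * (1 / (m + 1)) ^ Suc i \<le> (m - 1) * (1 / (m + 1)) ^ Suc i"
    by (intro mult_right_mono idx_le) auto
  then show "norm (real (idx (x i)) * (1 / (m + 1)) ^ Suc i) \<le> (m - 1) * (1 / (m + 1)) ^ Suc i"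
    by (simp add: abs_mult)
qed

lemma val_nonneg: "x \<in> full_shift A \<Longrightarrow> 0 \<le> val x"
  unfolding val_def by (intro suminf_nonneg summable_val) auto

lemma val_le: "x \<in> full_shift A \<Longrightarrow> val x \<le> (m - 1) / m"
  unfolding val_def
  by (subst sums_unique[OF max_digit_sums], intro suminf_le summable_val sums_summable[OF max_digit_sums] mult_right_mono)
     (auto simp: idx_le full_shift_def)

lemma val_rec:
  assumes "x \<in> full_shift A"
  shows "val x = (real (idx (x 0)) + val (shift x)) / (m + 1)"
proof -
  have "val x = real (idx (x 0)) * (1 / (m + 1)) ^ Suc 0
      + (\<Sum>i. real (idx (x (Suc i))) * (1 / (m + 1)) ^ Suc (Suc i))"
    unfolding val_def by (subst suminf_split_head[OF summable_val[OF assms]]) simp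
  also have "(\<Sum>i. real (idx (x (Suc i))) * (1 / (m + 1)) ^ Suc (Suc i))
      = (\<Sum>i. (1 / (m + 1)) * (real (idx (shift x i)) * (1 / (m + 1)) ^ Suc i))"
    by (simp add: shift_def algebra_simps)
  also have "\<dots> = (1 / (m + 1)) * val (shift x)"
    unfolding val_def by (rule suminf_mult[OF summable_val]) (use assms in simp)
  finally show ?thesis
    by (simp add: add_divide_distrib)
qed

lemma val_close:
  assumes "x \<in> full_shift A" "y \<in> full_shift A" "pref x n = pref y n"
  shows "\<bar>val x - val y\<bar> \<le> (1 / (m + 1)) ^ n"
  using assms
proof (induction n arbitrary: x y)
  case 0
  have "(m - 1) / m \<le> 1"
    using m_ge_1 by simp
  then show ?case
    using val_nonneg[OF 0(1)] val_nonneg[OF 0(2)] val_le[OF 0(1)] val_le[OF 0(2)] by simp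
next
  case (Suc n)
  then have "x 0 = y 0" "pref (shift x) n = pref (shift y) n"
    by (auto simp: pref_Suc_Cons)
  then have "\<bar>val (shift x) - val (shift y)\<bar> \<le> (1 / (m + 1)) ^ n"
    using Suc by simp
  then have "\<bar>val (shift x) - val (shift y)\<bar> / (m + 1) \<le> (1 / (m + 1)) ^ n / (m + 1)"
    using m_ge_1 by (intro divide_right_mono) auto
  moreover have "val x - val y = (val (shift x) - val (shift y)) / (m + 1)"
    using val_rec[OF Suc(2)] val_rec[OF Suc(3)] \<open>x 0 = y 0\<close> by (simp add: diff_divide_distrib add_divide_distrib)
  ultimately show ?case
    using m_ge_1 by (simp add: abs_divide)
qed

text \<open>The least difference of \<open>val\<close> when the first disagreement is at position j:
  the digits differ by one, the smaller sequence continues with the largest tail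
  \<open>(m - 1) / m\<close> and the larger one with zeros, which leaves \<open>1 / m\<close> at
  that scale.\<close>

definition gap :: "nat \<Rightarrow> real" where
  "gap j = 1 / m * (1 / (m + 1)) ^ Suc j"

lemma gap_pos: "0 < gap j"
  using m_ge_1 by (simp add: gap_def)

lemma gap_antimono: "i \<le> j \<Longrightarrow> gap j \<le> gap i"
  using m_ge_1 unfolding gap_def by (intro mult_left_mono power_decreasing) auto

lemma val_less:
  assumes "x \<in> full_shift A" "y \<in> full_shift A" "pref x j = pref y j" "idx (x j) < idx (y j)"
  shows "val x + gap j \<le> val y"
  using assms
proof (induction j arbitrary: x y)
  case 0
  have "val x + gap 0 \<le> (real (idx (x 0)) + (m - 1) / m) / (m + 1) + 1 / m / (m + 1)"
    using val_rec[OF 0(1)] val_le[of "shift x"] 0(1) m_ge_1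
    by (simp add: gap_def divide_right_mono)
  also have "\<dots> = (real (idx (x 0)) + 1) / (m + 1)"
    using digit_sum_carry[of m] m_ge_1 by simp
  also have "\<dots> \<le> (real (idx (y 0)) + val (shift y)) / (m + 1)"
    using 0 val_nonneg[of "shift y"] m_ge_1 by (intro divide_right_mono) auto
  finally show ?case
    using val_rec[OF 0(2)] by simp
next
  case (Suc j)
  then have eq: "x 0 = y 0" "pref (shift x) j = pref (shift y) j"
    by (auto simp: pref_Suc_Cons)
  then have "val (shift x) + gap j \<le> val (shift y)"
    using Suc by (intro Suc.IH) (auto simp: shift_def full_shift_def)
  then have "(real (idx (x 0)) + val (shift x) + gap j) / (m + 1) \<le> (real (idx (y 0)) + val (shift y)) / (m + 1)"
    using m_ge_1 eq by (intro divide_right_mono) auto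
  moreover have "gap (Suc j) = gap j / (m + 1)"
    by (simp add: gap_def)
  ultimately show ?case
    using val_rec[OF Suc(2)] val_rec[OF Suc(3)] by (simp add: add_divide_distrib)
qed

lemma continuous_map_val: "continuous_map (seq_topology A) euclideanreal val"
  unfolding continuous_map_def topspace_seq_topology
proof (intro conjI allI impI)
  fix U :: "real set" assume "openin euclideanreal U"
  then have U: "open U"
    by simp
  show "openin (seq_topology A) {x \<in> full_shift A. val x \<in> U}"
  proof (rule openin_seq_topologyI)
    fix x assume "x \<in> {x \<in> full_shift A. val x \<in> U}"
    then have x: "x \<in> full_shift A" "val x \<in> U"
      by auto
    then obtain e where e: "0 < e" "ball (val x) e \<subseteq> U"
      using U open_contains_ball by blast
    obtain n where n: "(1 / (m + 1)) ^ n < e"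
      using real_arch_pow_inv[OF e(1), of "1 / (m + 1)"] m_ge_1 by auto
    have "val y \<in> U" if "y \<in> full_shift A" "pref y n = pref x n" for y
    proof -
      have "\<bar>val y - val x\<bar> < e"
        using val_close[OF that(1) x(1) that(2)] n by simp
      then have "val y \<in> ball (val x) e"
        by (simp add: dist_real_def abs_minus_commute)
      then show ?thesis
        using e by blast
    qed
    then show "\<exists>n. \<forall>y\<in>full_shift A. pref y n = pref x n \<longrightarrow> y \<in> {x \<in> full_shift A. val x \<in> U}"
      by blast
  qed auto
qed auto

section \<open>The subshifts \<open>below c\<close> and continuity from the right\<close>

definition below :: "real \<Rightarrow> (nat \<Rightarrow> 'e) set" where
  "below c = {x \<in> full_shift A. \<forall>n. val ((shift ^^ n) x) \<le> c}"

lemma below_subset: "below c \<subseteq> full_shift A"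
  by (auto simp: below_def)

lemma below_mono: "c \<le> c' \<Longrightarrow> below c \<subseteq> below c'"
  by (auto simp: below_def intro: order_trans)

lemma continuous_map_funpow_shift:
  "continuous_map (seq_topology A) (seq_topology A) (shift ^^ n)"
proof -
  have "continuous_map (seq_topology A) (discrete_topology A) (\<lambda>x. x (i + n))" for i
    by (rule continuous_map_product_projection) auto
  then show ?thesis
    by (simp add: continuous_map_componentwise_UNIV funpow_shift)
qed

lemma subshift_below: "subshift A (below c)"
  unfolding subshift_def
proof (intro conjI ballI)
  have "closedin (seq_topology A) {x \<in> topspace (seq_topology A). (val \<circ> (shift ^^ n)) x \<in> {..c}}" for n
    by (rule closedin_continuous_map_preimage
        [OF continuous_map_compose[OF continuous_map_funpow_shift continuous_map_val]]) auto
  then have "closedin (seq_topology A)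
      (\<Inter>n\<in>UNIV. {x \<in> topspace (seq_topology A). (val \<circ> (shift ^^ n)) x \<in> {..c}})"
    by (intro closedin_INT) auto
  moreover have "(\<Inter>n\<in>UNIV. {x \<in> topspace (seq_topology A). (val \<circ> (shift ^^ n)) x \<in> {..c}}) = below c"
    unfolding topspace_seq_topology by (auto simp: below_def)
  ultimately show "closedin (seq_topology A) (below c)"
    by simp
  fix x assume x: "x \<in> below c"
  have "val ((shift ^^ n) (shift x)) \<le> c" for n
  proof -
    have "(shift ^^ n) (shift x) = (shift ^^ Suc n) x"
      by (simp only: funpow_Suc_right o_apply)
    then show ?thesis
      using x unfolding below_def by (simp del: funpow.simps)
  qed
  then show "shift x \<in> below c"
    using x by (simp add: below_def)
qed

lemma below_attains_max:
  assumes "below c \<noteq> {}"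
  obtains \<theta> where "\<theta> \<in> below c" "\<And>x. x \<in> below c \<Longrightarrow> val x \<le> val \<theta>"
proof -
  have "compactin (seq_topology A) (below c)"
    using subshift_below compact_space_seq_topology[OF finite_A]
    by (intro closedin_compact_space) (auto simp: subshift_def)
  from image_compactin[OF this continuous_map_val] have "compact (val ` below c)"
    by simp
  then show thesis
    using compact_attains_sup[of "val ` below c"] assms that by auto
qed

text \<open>Shift invariance turns a bound for \<open>val\<close> on \<open>below c\<close> into a
  bound along whole orbits. This allows c to be lowered to the largest value attained.\<close>

lemma below_max_eq:
  assumes "\<And>x. x \<in> below c \<Longrightarrow> val x \<le> c'"
  shows "below c \<subseteq> below c'"
  using assms subshift_shift[OF subshift_below] by (auto simp: below_def)

text \<open>Compactness: if every level above c left a point without prefix in \<open>W\<close>,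
  these closed sets, nested along \<open>c + 1 / Suc n\<close>, would share a point, and that point
  would lie uncovered in \<open>below c\<close>.\<close>

lemma covered_by_right:
  assumes "covered_by (below c) W"
  obtains c' where "c < c'" "covered_by (below c') W"
proof (rule ccontr)
  assume "\<not> thesis"
  with that have no: "\<not> covered_by (below c') W" if "c < c'" for c'
    using \<open>c < c'\<close> by blast
  define C where "C n = below (c + 1 / real (Suc n)) \<inter> {x \<in> full_shift A. \<forall>k. pref x k \<notin> W}" for n
  have cl: "closedin (seq_topology A) {x \<in> full_shift A. \<forall>k. pref x k \<notin> W}"
    unfolding closedin_def topspace_seq_topology
  proof
    have "full_shift A - {x \<in> full_shift A. \<forall>k. pref x k \<notin> W}
        = {x \<in> full_shift A. \<exists>k. pref x k \<in> W}"
      by auto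
    then show "openin (seq_topology A) (full_shift A - {x \<in> full_shift A. \<forall>k. pref x k \<notin> W})"
      by (simp only: openin_prefix_in)
  qed auto
  have "(\<Inter>n. C n) \<noteq> {}"
  proof (rule compact_space_imp_nest[OF compact_space_seq_topology[OF finite_A]])
    show "closedin (seq_topology A) (C n)" for n
      unfolding C_def using subshift_below cl by (intro closedin_Int) (auto simp: subshift_def)
    show "C n \<noteq> {}" for n
      using no[of "c + 1 / real (Suc n)"] below_subset unfolding C_def covered_by_def by fastforce
    show "decseq C"
      unfolding C_def by (intro decseq_SucI Int_mono below_mono) (auto simp: field_simps)
  qed
  then obtain x where x: "\<And>n. x \<in> C n"
    by blast
  have "val ((shift ^^ k) x) \<le> c" for k
  proof (rule field_le_epsilon)
    fix e :: real assume "0 < e"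
    then obtain n where "1 / real (Suc n) < e"
      using nat_approx_posE by blast
    moreover have "val ((shift ^^ k) x) \<le> c + 1 / real (Suc n)"
      using x[of n] by (auto simp: C_def below_def)
    ultimately show "val ((shift ^^ k) x) \<le> c + e"
      by simp
  qed
  then have "x \<in> below c"
    using x[of 0] by (auto simp: C_def below_def)
  then show False
    using assms x[of 0] by (auto simp: covered_by_def C_def)
qed

text \<open>As for beta-shifts, every sequence of \<open>below (val \<theta>)\<close> is a concatenation of these words,
  possibly followed by \<open>\<theta>\<close>.\<close>

definition code :: "(nat \<Rightarrow> 'e) \<Rightarrow> nat \<Rightarrow> 'e list set" where
  "code \<theta> k = {pref \<theta> j @ [a] |j a. j < k \<and> a \<in> A \<and> idx a < idx (\<theta> j)}"

lemma code_lists: "\<theta> \<in> full_shift A \<Longrightarrow> code \<theta> k \<subseteq> lists A"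
  by (auto simp: code_def pref_def full_shift_def)

lemma finite_code: "finite (code \<theta> k)"
proof (rule finite_subset)
  show "code \<theta> k \<subseteq> (\<lambda>(j, a). pref \<theta> j @ [a]) ` ({..<k} \<times> A)"
    by (auto simp: code_def)
qed (use finite_A in auto)

lemma Nil_notin_code: "[] \<notin> code \<theta> k"
  by (auto simp: code_def)

text \<open>For \<open>j < j'\<close>, one word has a letter below \<open>\<theta> j\<close> at
  position j, the other has \<open>\<theta> j\<close> itself.\<close>

lemma prefix_free_code: "prefix_free (code \<theta> k)"
proof -
  have False if "j < j'" "idx a < idx (\<theta> j)" "pref \<theta> j @ [a] @ p = pref \<theta> j' @ [a'] @ q" for j j' a a' p q
  proof -
    have "(pref \<theta> j @ [a] @ p) ! j = a"
      by (simp add: nth_append)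
    moreover have "(pref \<theta> j' @ [a'] @ q) ! j = \<theta> j"
      using that(1) by (simp add: nth_append pref_def)
    ultimately show False
      using that by simp
  qed
  note no = this
  show ?thesis
    unfolding prefix_free_def
  proof (intro ballI allI impI)
    fix u v p q assume "u \<in> code \<theta> k" "v \<in> code \<theta> k" and eq: "u @ p = v @ q"
    then obtain j a j' a' where u: "u = pref \<theta> j @ [a]" "idx a < idx (\<theta> j)"
      and v: "v = pref \<theta> j' @ [a']" "idx a' < idx (\<theta> j')"
      unfolding code_def by blast
    have "j = j'"
      using no[of j j' a p a' q] no[of j' j a' q a p] u v eq by (cases j j' rule: linorder_cases) auto
    then show "u = v"
      using eq u v by simp
  qed
qed

text \<open>As \<open>val\<close> respects the lexicographic order and
  \<open>val x \<le> val \<theta>\<close>, the first letter at which x leaves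
  \<open>\<theta>\<close> is smaller, and the prefix ending there is a code word.\<close>

lemma below_parse:
  assumes "\<theta> \<in> below c" "c = val \<theta>" "x \<in> below c"
  shows "(\<exists>n. pref x n \<in> code \<theta> k) \<or> pref x k = pref \<theta> k"
proof (cases "pref x k = pref \<theta> k")
  case False
  then obtain j0 where "j0 < k \<and> x j0 \<noteq> \<theta> j0"
    by (auto simp: pref_eq_iff)
  then obtain j where j: "j < k" "x j \<noteq> \<theta> j" and least: "\<And>i. i < j \<Longrightarrow> x i = \<theta> i"
    using ex_least_nat_le[of "\<lambda>j. j < k \<and> x j \<noteq> \<theta> j"] by (metis order_le_less_trans less_imp_le)
  have full: "x \<in> full_shift A" "\<theta> \<in> full_shift A"
    using assms below_subset by auto
  have pr: "pref x j = pref \<theta> j"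
    using least by (simp add: pref_eq_iff)
  have "idx (x j) \<noteq> idx (\<theta> j)"
    using j full idx by (auto simp: bij_betw_def inj_on_def full_shift_def)
  moreover have "\<not> idx (\<theta> j) < idx (x j)"
  proof
    assume "idx (\<theta> j) < idx (x j)"
    then have "val \<theta> + gap j \<le> val x"
      using full pr by (intro val_less) auto
    moreover have "val x \<le> c"
      using assms(3) unfolding below_def by (auto dest: spec[of _ 0])
    ultimately show False
      using assms(2) gap_pos[of j] by simp
  qed
  ultimately have "pref x (Suc j) \<in> code \<theta> k"
    using j(1) pr full unfolding code_def
    by (auto simp: pref_Suc full_shift_def intro!: exI[of _ j])
  then show ?thesis
    by blast
qed auto

text \<open>Locates position i within its block: l is the start of the block and
  \<open>l + j\<close> the place of its final, lowered letter.\<close>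

lemma wpow_code_position:
  assumes "u \<in> wpow (code \<theta> k) n" "i < length u"
  shows "\<exists>l j a. j < k \<and> l \<le> i \<and> i \<le> l + j \<and> l + j < length u \<and> idx a < idx (\<theta> j) \<and>
    (\<forall>p<j. u ! (l + p) = \<theta> p) \<and> u ! (l + j) = a"
  using assms
proof (induction n arbitrary: u i)
  case (Suc n)
  then obtain c v where cv: "c \<in> code \<theta> k" "v \<in> wpow (code \<theta> k) n" "u = c @ v"
    by auto
  then obtain j a where ja: "j < k" "idx a < idx (\<theta> j)" "c = pref \<theta> j @ [a]"
    unfolding code_def by blast
  show ?case
  proof (cases "i < length c")
    case True
    have "\<forall>p<j. u ! (0 + p) = \<theta> p"
      using cv ja by (simp add: nth_append pref_def)
    moreover have "u ! (0 + j) = a"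
      using cv ja by (simp add: nth_append)
    ultimately show ?thesis
      using True ja cv by (intro exI[of _ 0] exI[of _ j] exI[of _ a]) auto
  next
    case False
    then have "i - length c < length v"
      using Suc.prems cv by auto
    from Suc.IH[OF cv(2) this] obtain l j a where
      *: "j < k" "l \<le> i - length c" "i - length c \<le> l + j" "l + j < length v"
         "idx a < idx (\<theta> j)" "\<forall>p<j. v ! (l + p) = \<theta> p" "v ! (l + j) = a"
      by blast
    then show ?thesis
      using False cv(3)
      by (intro exI[of _ "length c + l"] exI[of _ j] exI[of _ a]) (auto simp: nth_append add.assoc)
  qed
qed auto

text \<open>Why finite parts of the code live strictly below c: a suffix starting at offset d of a
  block follows \<open>(shift ^^ d) \<theta>\<close>, whose value is at most c, and drops below it
  at one of its first k letters. This costs at least \<open>gap k\<close>, uniformly in u.\<close>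

lemma wpow_code_extend:
  assumes \<theta>: "\<theta> \<in> below c" "c = val \<theta>" and u: "u \<in> wpow (code \<theta> k) n" and c': "0 \<le> c'" "c - gap k \<le> c'"
  shows "\<exists>x\<in>below c'. \<exists>l. u = pref x l"
proof -
  have full: "\<theta> \<in> full_shift A"
    using \<theta> below_subset by auto
  \<comment> \<open>Padding with the letter of digit 0 gives every suffix beyond u the value 0; this
    is where \<open>0 \<le> c'\<close> enters.\<close>
  obtain z where z: "z \<in> A" "idx z = 0"
    using idx m_ge_1 unfolding bij_betw_def
    by (metis (no_types, lifting) image_iff lessThan_iff of_nat_0 not_one_le_zero bot_nat_0.not_eq_extremum)
  define x where "x i = (if i < length u then u ! i else z)" for i
  have uA: "u \<in> lists A"
    using u wpow_lists[OF code_lists[OF full]] by blast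
  have xfull: "x \<in> full_shift A"
    using uA z by (auto simp: x_def full_shift_def in_lists_conv_set)
  have "val ((shift ^^ i) x) \<le> c'" for i
  proof (cases "i < length u")
    case False
    then have "val ((shift ^^ i) x) = 0"
      using z by (simp add: val_def funpow_shift x_def)
    then show ?thesis
      using c' by simp
  next
    case True
    then obtain l j a where *: "j < k" "l \<le> i" "i \<le> l + j" "l + j < length u"
      "idx a < idx (\<theta> j)" "\<forall>p<j. u ! (l + p) = \<theta> p" "u ! (l + j) = a"
      using wpow_code_position[OF u] by blast
    define d where "d = i - l"
    have d: "i = l + d" "d \<le> j"
      using * by (auto simp: d_def)
    have "val ((shift ^^ i) x) + gap (j - d) \<le> val ((shift ^^ d) \<theta>)"
    proof (rule val_less)
      show "pref ((shift ^^ i) x) (j - d) = pref ((shift ^^ d) \<theta>) (j - d)"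
        unfolding pref_eq_iff
      proof (intro allI impI)
        fix p assume p: "p < j - d"
        then have "u ! (l + (p + d)) = \<theta> (p + d)"
          using *(6) by (metis less_diff_conv)
        moreover have "l + (p + d) < length u"
          using p * by linarith
        ultimately show "(shift ^^ i) x p = (shift ^^ d) \<theta> p"
          using d by (simp add: funpow_shift x_def ac_simps)
      qed
      show "idx ((shift ^^ i) x (j - d)) < idx ((shift ^^ d) \<theta> (j - d))"
        using * d by (simp add: funpow_shift x_def ac_simps)
    qed (use xfull full in auto)
    moreover have "gap k \<le> gap (j - d)"
      using * by (intro gap_antimono) auto
    moreover have "val ((shift ^^ d) \<theta>) \<le> c"
      using \<theta> by (auto simp: below_def)
    ultimately show ?thesis
      using c' by linarith
  qed
  then have "x \<in> below c'"
    using xfull by (simp add: below_def)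
  moreover have "u = pref x (length u)"
    by (rule nth_equalityI) (auto simp: pref_def x_def)
  ultimately show ?thesis
    by blast
qed

text \<open>All powers of \<open>code \<theta> k\<close> occur in the language of one
  \<open>below c'\<close> with \<open>c' < c\<close>. Its dimension is below t, so Furstenberg's
  parsing bounds the weights for all n, and supermultiplicativity replaces that bound by
  \<open>1 / q powr t\<close>, which is free of k and n.\<close>

lemma weight_wpow_code_le:
  assumes \<theta>: "\<theta> \<in> below c" "c = val \<theta>" and t: "0 < t" and small: "\<And>c'. c' < c \<Longrightarrow> D (below c') < ennreal t"
  shows "q powr t * weight t (wpow (code \<theta> k) n) \<le> 1"
\<comment> \<open>If c is 0 there is no level with \<open>0 \<le> c'\<close> and
  \<open>c' < c\<close>. In that case no digit of \<open>\<theta>\<close> can be lowered, so the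
  code is empty and at most the empty word remains.\<close>
proof (cases "c = 0")
  case True
  have full: "\<theta> \<in> full_shift A"
    using \<theta> below_subset by auto
  have "code \<theta> k = {}"
  proof (rule ccontr)
    assume "code \<theta> k \<noteq> {}"
    then obtain j a where ja: "a \<in> A" "idx a < idx (\<theta> j)"
      by (auto simp: code_def)
    define y where "y = \<theta>(j := a)"
    have y: "y \<in> full_shift A"
      using full ja by (auto simp: y_def full_shift_def)
    have "val y + gap j \<le> val \<theta>"
      by (rule val_less) (use y full ja in \<open>auto simp: y_def pref_eq_iff\<close>)
    then show False
      using True \<theta>(2) val_nonneg[OF y] gap_pos[of j] by simp
  qed
  then have "wpow (code \<theta> k) n \<subseteq> {[]}" "n \<noteq> 0 \<Longrightarrow> wpow (code \<theta> k) n = {}"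
    by (cases n; simp)+
  moreover have "q * (r [] * r []) \<le> r []"
    using r_append_ge[of "[]" "[]"] by simp
  then have "q * r [] \<le> 1"
    using r_pos[of "[]"] by (simp flip: mult.assoc)
  then have "(q * r []) powr t \<le> 1"
    using q_pos r_pos[of "[]"] t by (intro powr_le1) auto
  ultimately show ?thesis
    by (cases "n = 0") (auto simp: powr_mult)
next
  case False
  have full: "\<theta> \<in> full_shift A"
    using \<theta> below_subset by auto
  then have c: "0 < c"
    using False \<theta>(2) val_nonneg[of \<theta>] by simp
  define c' where "c' = max 0 (c - gap k)"
  have c': "0 \<le> c'" "c - gap k \<le> c'" "c' < c"
    using c gap_pos[of k] by (auto simp: c'_def)
  obtain W where W: "finite W" "W \<subseteq> lists A" "[] \<notin> W" "covered_by (below c') W" "weight t W < 1"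
    using dim_less_imp_cover[OF subshift_below t small[OF c'(3)]] by blast
  obtain B where B: "\<And>G. finite G \<Longrightarrow> (\<And>g. g \<in> G \<Longrightarrow> \<exists>x\<in>below c'. \<exists>n. g = pref x n) \<Longrightarrow> weight t G \<le> B"
    using weight_language_bounded[OF W(1,2,3,5) t W(4) below_subset subshift_shift[OF subshift_below]]
    by blast
  show ?thesis
  proof (rule supermultiplicative_bounded)
    show "q powr t * (weight t (wpow (code \<theta> k) i) * weight t (wpow (code \<theta> k) n)) \<le> weight t (wpow (code \<theta> k) (i + n))" for i n
      by (rule weight_wpow_add_ge[OF finite_code code_lists[OF full] t prefix_free_code])
    show "weight t (wpow (code \<theta> k) n) \<le> B" for n
      using wpow_code_extend[OF \<theta> _ c'(1,2)] by (intro B finite_wpow finite_code) blast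
  qed (use q_pos weight_nonneg in auto)
qed

text \<open>Reading code words from the truncated code stalls only where the rest of the sequence
  follows \<open>\<theta>\<close> for k letters; stopping there keeps the set of words
  finite.\<close>

lemma below_parse_wpow:
  assumes "\<theta> \<in> below c" "c = val \<theta>" "x \<in> below c"
  shows "\<exists>l. pref x l \<in> wpow (code \<theta> k) n \<union> (\<Union>j<n. (\<lambda>v. v @ pref \<theta> k) ` wpow (code \<theta> k) j)"
  using assms(3)
proof (induction n arbitrary: x)
  case 0
  show ?case
    by (intro exI[of _ 0]) auto
next
  case (Suc n)
  consider l where "pref x l \<in> code \<theta> k" | "pref x k = pref \<theta> k"
    using below_parse[OF assms(1,2) Suc.prems] by blast
  then show ?case
  proof cases
    case 1
    have "(shift ^^ l) x \<in> below c"
      using Suc.prems by (rule subshift_shift[OF subshift_below])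
    from Suc.IH[OF this] obtain i where
      "pref ((shift ^^ l) x) i \<in> wpow (code \<theta> k) n \<union> (\<Union>j<n. (\<lambda>v. v @ pref \<theta> k) ` wpow (code \<theta> k) j)"
      by blast
    then consider "pref ((shift ^^ l) x) i \<in> wpow (code \<theta> k) n"
      | j v where "j < n" "v \<in> wpow (code \<theta> k) j" "pref ((shift ^^ l) x) i = v @ pref \<theta> k"
      by blast
    then show ?thesis
    proof cases
      case a: 1
      then show ?thesis
        using 1 by (intro exI[of _ "l + i"]) (auto simp: pref_add)
    next
      case a: 2
      have "pref x l @ v \<in> wpow (code \<theta> k) (Suc j)"
        using 1 a by auto
      then show ?thesis
        using a by (intro exI[of _ "l + i"] UnI2 UN_I[of "Suc j"] image_eqI[of _ _ "pref x l @ v"])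
          (auto simp: pref_add)
    qed
  next
    case 2
    then show ?thesis
      by (intro exI[of _ k] UnI2 UN_I[of 0]) auto
  qed
qed

lemma power_lt_eventually:
  assumes "0 < z" "z < 1" "0 \<le> b" "0 < (e::real)"
  obtains n where "1 \<le> n" "b * z ^ n < e"
proof -
  have "0 < e / (b + 1)"
    using assms by simp
  then obtain n where "z ^ n < e / (b + 1)"
    using real_arch_pow_inv[of "e / (b + 1)" z] assms by blast
  moreover have "z ^ Suc n \<le> z ^ n"
    using assms by (intro power_decreasing) auto
  ultimately have "z ^ Suc n < e / (b + 1)"
    by linarith
  then have "(b + 1) * z ^ Suc n < e"
    using assms by (simp add: pos_less_divide_eq mult.commute)
  moreover have "b * z ^ Suc n \<le> (b + 1) * z ^ Suc n"
    using assms by (intro mult_right_mono) auto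
  ultimately show thesis
    using that[of "Suc n"] by simp
qed

text \<open>The cover consists of n code words, or fewer than n followed by the first k letters of
  \<open>\<theta>\<close>. At exponent \<open>t'\<close> the first kind weighs at most
  \<open>b * (s powr d) ^ n\<close> for every k, so n can be fixed first and k chosen afterwards to
  make the second kind small.\<close>

lemma dim_below_left:
  assumes \<theta>: "\<theta> \<in> below c" "c = val \<theta>" and t: "0 < t" "t < t'" and small: "\<And>c'. c' < c \<Longrightarrow> D (below c') < ennreal t"
  shows "D (below c) \<le> ennreal t'"
proof -
  have full: "\<theta> \<in> full_shift A"
    using \<theta> below_subset by auto
  define d where "d = t' - t"
  have d: "0 < d"
    using t by (simp add: d_def)
  \<comment> \<open>\<open>K powr d\<close> comes from the decay of the weights,
    \<open>1 / q powr t\<close> from the bound at exponent t.\<close>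
  define b where "b = K powr d / q powr t"
  have b: "0 < b"
    using K_pos q_pos by (simp add: b_def)
  have pw: "weight t' (wpow (code \<theta> k) n) \<le> b * (s powr d) ^ n" for k n
  proof -
    have "weight t' (wpow (code \<theta> k) n) \<le> (K * s ^ n) powr (t' - t) * weight t (wpow (code \<theta> k) n)"
      using t length_wpow[OF Nil_notin_code] wpow_lists[OF code_lists[OF full]]
      by (intro weight_exponent_le) auto
    also have "\<dots> \<le> (K * s ^ n) powr (t' - t) * (1 / q powr t)"
      using weight_wpow_code_le[OF \<theta> t(1) small, of k n] q_pos
      by (intro mult_left_mono) (auto simp: field_simps)
    also have "\<dots> = b * (s powr d) ^ n"
      using K_pos s by (simp add: b_def d_def powr_mult powr_realpow[symmetric] powr_powr mult.commute)
    finally show ?thesis .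
  qed
  have sd: "0 < s powr d" "s powr d < 1"
    using s d powr_less_mono2[of d s 1] by auto
  have st: "0 < s powr t'" "s powr t' < 1"
    using s t powr_less_mono2[of t' s 1] by auto
  \<comment> \<open>The lower bounds 1 on n and on k below keep the empty word out of the
    cover.\<close>
  obtain n where n: "1 \<le> n" "b * (s powr d) ^ n < 1 / 2"
    using power_lt_eventually[OF sd, of b "1 / 2"] b by auto
  have "0 \<le> real n * b * K powr t'"
    using b by simp
  then obtain k where k: "1 \<le> k" "real n * b * K powr t' * (s powr t') ^ k < 1 / 2"
    using power_lt_eventually[OF st, of "real n * b * K powr t'" "1 / 2"] by auto
  have rk: "r (pref \<theta> k) powr t' \<le> K powr t' * (s powr t') ^ k"
  proof -
    have "r (pref \<theta> k) powr t' \<le> (K * s ^ k) powr t'"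
      using r_decay[of "pref \<theta> k"] r_pos[of "pref \<theta> k"] full t by (intro powr_mono2) auto
    also have "\<dots> = K powr t' * (s powr t') ^ k"
      using K_pos s by (simp add: powr_mult powr_realpow[symmetric] powr_powr mult.commute)
    finally show ?thesis .
  qed
  define V where "V j = (\<lambda>(v, p). v @ p) ` (wpow (code \<theta> k) j \<times> {pref \<theta> k})" for j
  define W where "W = wpow (code \<theta> k) n \<union> (\<Union>j<n. V j)"
  have finV: "finite (V j)" for j
    by (simp add: V_def finite_wpow finite_code)
  have VA: "V j \<subseteq> lists A" for j
    using wpow_lists[OF code_lists[OF full], of k j] pref_in_lists[OF full, of k]
    unfolding V_def by (auto simp: subset_iff in_lists_conv_set)
  have wV: "weight t' (V j) \<le> b * (K powr t' * (s powr t') ^ k)" for j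
  proof -
    have "weight t' (V j) \<le> weight t' (wpow (code \<theta> k) j) * weight t' {pref \<theta> k}"
      unfolding V_def using wpow_lists[OF code_lists[OF full], of k j] pref_in_lists[OF full, of k] t
      by (intro weight_product_le finite_wpow finite_code) auto
    also have "\<dots> \<le> b * (s powr d) ^ j * (K powr t' * (s powr t') ^ k)"
      using pw[of k j] rk b by (intro mult_mono) (auto simp: weight_nonneg)
    also have "\<dots> \<le> b * 1 * (K powr t' * (s powr t') ^ k)"
      using sd b by (intro mult_right_mono mult_left_mono power_le_one) auto
    finally show ?thesis
      by simp
  qed
  have "weight t' W \<le> weight t' (wpow (code \<theta> k) n) + weight t' (\<Union>j<n. V j)"
    unfolding W_def using finV
    by (subst sum.union_inter[symmetric]) (auto simp: finite_wpow finite_code sum_nonneg)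
  also have "weight t' (\<Union>j<n. V j) \<le> (\<Sum>p\<in>(SIGMA j:{..<n}. V j). r (snd p) powr t')"
    by (rule sum_le_sum_image_superset) (use finV in \<open>auto simp: image_iff\<close>)
  also have "\<dots> = (\<Sum>j<n. weight t' (V j))"
    by (subst sum.Sigma) (use finV in \<open>auto simp: case_prod_beta\<close>)
  also have "\<dots> \<le> (\<Sum>j<n. b * (K powr t' * (s powr t') ^ k))"
    by (intro sum_mono wV)
  also have "\<dots> = real n * b * K powr t' * (s powr t') ^ k"
    by simp
  finally have weight: "weight t' W < 1"
    using k n pw[of k n] by simp
  have "[] \<notin> wpow (code \<theta> k) n"
    using length_wpow[OF Nil_notin_code, of "[]" \<theta> k n] n by auto
  moreover have "pref \<theta> k \<noteq> []"
    using k length_pref[of \<theta> k] by (metis list.size(3) not_one_le_zero)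
  ultimately have Nil: "[] \<notin> W"
    by (auto simp: W_def V_def)
  have cov: "covered_by (below c) W"
    using below_parse_wpow[OF \<theta>, where k = k and n = n] unfolding covered_by_def W_def V_def
    by (auto simp: image_def)
  have "finite W" "W \<subseteq> lists A"
    unfolding W_def using finV VA wpow_lists[OF code_lists[OF full], of k n]
    by (auto simp: finite_wpow finite_code simp del: in_lists_conv_set)
  from cover_imp_dim_le[OF subshift_below _ this Nil cov weight] t show ?thesis
    by simp
qed

theorem dimension_spectrum: "{D X |X. subshift A X} = {0..D (full_shift A)}"
proof (intro equalityI subsetI)
  fix y assume "y \<in> {D X |X. subshift A X}"
  then show "y \<in> {0..D (full_shift A)}"
    using dim_mono[OF subshift_subset] by auto
next
  fix y assume y: "y \<in> {0..D (full_shift A)}"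
  consider "y = 0" | "y = D (full_shift A)" | "0 < y" "y < D (full_shift A)"
    using y by (auto simp: order_le_less)
  then show "y \<in> {D X |X. subshift A X}"
  proof cases
    case 1
    then show ?thesis
      using dim_empty subshift_empty by force
  next
    case 2
    then show ?thesis
      using subshift_full by blast
  next
    case 3
    then obtain t where yt: "y = ennreal t" and t: "0 < t"
      by (cases y) auto
    \<comment> \<open>Contains -1 because \<open>val\<close> is nonnegative, and is bounded by 1
      because levels above 1 give the full shift, whose dimension exceeds t.\<close>
    define C where "C = {c. D (below c) \<le> ennreal t}"
    have neg: "below (- 1) = {}"
      using val_nonneg by (auto simp: below_def dest: spec[of _ 0]) (metis funpow_0 le_minus_one_simps(3) order_trans)
    have ne: "C \<noteq> {}"
      using neg dim_empty by (auto simp: C_def intro!: exI[of _ "- 1"])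
    have one: "(m - 1) / m \<le> 1"
      using m_ge_1 by simp
    have ub: "c \<le> 1" if "c \<in> C" for c
    proof (rule ccontr)
      assume "\<not> c \<le> 1"
      then have "full_shift A \<subseteq> below c"
        using val_le one unfolding below_def by (auto intro!: order_trans[OF val_le])
      then have "D (full_shift A) \<le> ennreal t"
        using that dim_mono[OF _ below_subset] unfolding C_def by (auto intro: order_trans)
      then show False
        using 3 yt by simp
    qed
    define c where "c = Sup C"
    have bdd: "bdd_above C"
      using ub by (auto simp: bdd_above_def)
    have less: "D (below c') \<le> ennreal t" if "c' < c" for c'
    proof -
      obtain c1 where "c1 \<in> C" "c' < c1"
        using \<open>c' < c\<close> ne bdd by (auto simp: c_def less_cSup_iff)
      then show ?thesis
        using dim_mono[OF below_mono[of c' c1] below_subset] by (auto simp: C_def intro: order_trans)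
    qed
    \<comment> \<open>Otherwise a cover for exponent t would survive at some level above c, which
      would then belong to \<open>C\<close>.\<close>
    have "ennreal t \<le> D (below c)"
    proof (rule ccontr)
      assume "\<not> ennreal t \<le> D (below c)"
      then obtain W where W: "finite W" "W \<subseteq> lists A" "[] \<notin> W" "covered_by (below c) W" "weight t W < 1"
        using dim_less_imp_cover[OF subshift_below t] by (meson not_le)
      obtain c' where c': "c < c'" "covered_by (below c') W"
        using covered_by_right[OF W(4)] .
      have "D (below c') \<le> ennreal t"
        by (rule cover_imp_dim_le[OF subshift_below t W(1-3) c'(2) W(5)])
      then have "c' \<le> c"
        unfolding c_def by (intro cSup_upper bdd) (simp add: C_def)
      then show False
        using c' by simp
    qed
    moreover have "D (below c) \<le> ennreal t"
    proof (cases "below c = {}")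
      case True
      then show ?thesis
        by (simp add: dim_empty)
    next
      case False
      then obtain \<theta> where \<theta>: "\<theta> \<in> below c" "\<And>x. x \<in> below c \<Longrightarrow> val x \<le> val \<theta>"
        using below_attains_max by blast
      have "val \<theta> \<le> c"
        using \<theta>(1) by (auto simp: below_def dest: spec[of _ 0])
      then consider "val \<theta> < c" | "c = val \<theta>"
        by force
      then show ?thesis
      proof cases
        case 1
        have "D (below c) \<le> D (below (val \<theta>))"
          by (intro dim_mono below_max_eq \<theta>(2) below_subset)
        then show ?thesis
          using less[OF 1] by (rule order_trans)
      next
        case 2
        show ?thesis
        proof (rule ennreal_le_epsilon)
          fix e :: real assume "0 < e"
          \<comment> \<open>Levels below c give only a weak inequality with t; the intermediate
            exponent makes it strict while staying below \<open>t + e\<close>.\<close>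
          then have "D (below c') < ennreal (t + e / 2)" if "c' < c" for c'
            using less[OF that] t by (auto intro!: order_le_less_trans[OF less[OF that]] ennreal_lessI)
          from dim_below_left[OF \<theta>(1) 2 _ _ this, of "t + e"]
          have "D (below c) \<le> ennreal (t + e)"
            using t \<open>0 < e\<close> by simp
          then show "D (below c) \<le> ennreal t + ennreal e"
            using t \<open>0 < e\<close> by (simp flip: ennreal_plus)
        qed
      qed
    qed
    ultimately have "D (below c) = y"
      using yt by simp
    then show ?thesis
      using subshift_below by blast
  qed
qed

end

section \<open>Hausdorff dimension\<close>

lemma diam_gauge_antimono_exponent:
  assumes "0 \<le> s" "s < t" "bounded U" "diameter U \<le> 1"
  shows "diam_gauge t U \<le> diam_gauge s U"
proof -
  have "0 \<le> diameter U"
    using assms(3) by (rule diameter_ge_0)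
  then have "diameter U powr t \<le> 1" "diameter U powr t \<le> diameter U powr s"
    using assms powr_le1[of t "diameter U"] powr_mono'[of s t "diameter U"] by auto
  then show ?thesis
    using assms by (auto simp: diam_gauge_def intro: ennreal_leI)
qed

lemma hausdorff_premeasure_le_suminf:
  "delta_cover \<delta> S U \<Longrightarrow> hausdorff_premeasure s \<delta> S \<le> (\<Sum>i. diam_gauge s (U i))"
  unfolding hausdorff_premeasure_def by (rule INF_lower) simp

lemma hausdorff_premeasure_le_finite:
  assumes "finite \<U>" "S \<subseteq> \<Union>\<U>" and "\<And>U. U \<in> \<U> \<Longrightarrow> bounded U \<and> diameter U \<le> \<delta>" and "0 \<le> \<delta>"
  shows "hausdorff_premeasure s \<delta> S \<le> (\<Sum>U\<in>\<U>. diam_gauge s U)"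
proof -
  obtain f where f: "bij_betw f {..<card \<U>} \<U>"
    using ex_bij_betw_nat_finite[OF assms(1)] by (auto simp: atLeast0LessThan)
  define V where "V i = (if i < card \<U> then f i else {})" for i
  have "delta_cover \<delta> S V"
    unfolding delta_cover_def
  proof (intro conjI allI)
    fix i
    show "bounded (V i)" "diameter (V i) \<le> \<delta>"
      using assms(3)[of "f i"] assms(4) bij_betwE[OF f] by (auto simp: V_def)
    show "S \<subseteq> (\<Union>i. V i)"
    proof
      fix x assume "x \<in> S"
      then obtain i where "i < card \<U>" "x \<in> f i"
        using assms(2) bij_betw_imp_surj_on[OF f] by blast
      then show "x \<in> (\<Union>i. V i)"
        by (auto simp: V_def)
    qed
  qed
  then have "hausdorff_premeasure s \<delta> S \<le> (\<Sum>i. diam_gauge s (V i))"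
    by (rule hausdorff_premeasure_le_suminf)
  also have "\<dots> = (\<Sum>i<card \<U>. diam_gauge s (V i))"
    by (rule suminf_finite) (auto simp: V_def diam_gauge_def)
  also have "\<dots> = (\<Sum>i<card \<U>. diam_gauge s (f i))"
    by (simp add: V_def)
  also have "\<dots> = (\<Sum>U\<in>\<U>. diam_gauge s U)"
    by (rule sum.reindex_bij_betw[OF f])
  finally show ?thesis .
qed

lemma hausdorff_measure_mono: "S \<subseteq> T \<Longrightarrow> hausdorff_measure s S \<le> hausdorff_measure s T"
proof -
  assume "S \<subseteq> T"
  then have "{U. delta_cover \<delta> T U} \<subseteq> {U. delta_cover \<delta> S U}" for \<delta>
    unfolding delta_cover_def by blast
  then have "hausdorff_premeasure s \<delta> S \<le> hausdorff_premeasure s \<delta> T" for \<delta>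
    unfolding hausdorff_premeasure_def by (rule INF_superset_mono) simp
  then show "hausdorff_measure s S \<le> hausdorff_measure s T"
    unfolding hausdorff_measure_def by (rule SUP_mono')
qed

lemma hausdorff_dim_mono: "S \<subseteq> T \<Longrightarrow> hausdorff_dim S \<le> hausdorff_dim T"
  unfolding hausdorff_dim_def
proof (rule Inf_superset_mono, safe)
  fix s :: real assume "S \<subseteq> T" "0 \<le> s" "hausdorff_measure s T = 0"
  then show "\<exists>s'. ennreal s = ennreal s' \<and> 0 \<le> s' \<and> hausdorff_measure s' S = 0"
    using hausdorff_measure_mono[of S T s] by auto
qed

lemma hausdorff_dim_leI:
  assumes "0 \<le> t" and "\<And>\<delta> \<epsilon>. 0 < \<delta> \<Longrightarrow> 0 < \<epsilon> \<Longrightarrow> hausdorff_premeasure t \<delta> S \<le> ennreal \<epsilon>"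
  shows "hausdorff_dim S \<le> ennreal t"
proof -
  have "hausdorff_premeasure t \<delta> S = 0" if "0 < \<delta>" for \<delta>
  proof -
    have "hausdorff_premeasure t \<delta> S \<le> 0"
    proof (rule ennreal_le_epsilon)
      show "hausdorff_premeasure t \<delta> S \<le> 0 + ennreal e" if "0 < e" for e
        using assms(2)[OF \<open>0 < \<delta>\<close> that] by simp
    qed
    then show ?thesis
      by simp
  qed
  then have "hausdorff_measure t S = 0"
    unfolding hausdorff_measure_def by (intro antisym SUP_least) auto
  then show ?thesis
    unfolding hausdorff_dim_def using assms(1) by (intro Inf_lower) auto
qed

lemma hausdorff_dim_empty: "hausdorff_dim {} = 0"
proof -
  have "hausdorff_dim ({} :: 'a set) \<le> ennreal 0"
  proof (rule hausdorff_dim_leI)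
    fix \<delta> \<epsilon> :: real assume "0 < \<delta>"
    then show "hausdorff_premeasure 0 \<delta> ({} :: 'a set) \<le> ennreal \<epsilon>"
      using hausdorff_premeasure_le_finite[of "{}" "{} :: 'a set" \<delta> 0] by simp
  qed simp
  then show ?thesis
    by simp
qed

lemma hausdorff_dim_less_obtain_cover:
  assumes "hausdorff_dim S < ennreal t" "0 < \<epsilon>" "0 < \<delta>"
  obtains U where "delta_cover \<delta> S U" "(\<Sum>i. diam_gauge t (U i)) < ennreal \<epsilon>"
proof -
  obtain s where s: "0 \<le> s" "hausdorff_measure s S = 0" "ennreal s < ennreal t"
    using assms(1) unfolding hausdorff_dim_def Inf_less_iff by blast
  then have st: "s < t"
    using ennreal_less_iff by blast
  \<comment> \<open>A mesh of at most 1 makes the gauge decrease when the exponent rises from s to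
    t.\<close>
  have "hausdorff_premeasure s (min \<delta> 1) S \<le> hausdorff_measure s S"
    unfolding hausdorff_measure_def by (rule SUP_upper) (use assms in auto)
  then have "hausdorff_premeasure s (min \<delta> 1) S < ennreal \<epsilon>"
    using s(2) assms(2) by (simp add: order_le_less_trans[of _ 0])
  then obtain U where U: "delta_cover (min \<delta> 1) S U" "(\<Sum>i. diam_gauge s (U i)) < ennreal \<epsilon>"
    unfolding hausdorff_premeasure_def INF_less_iff by blast
  have "(\<Sum>i. diam_gauge t (U i)) \<le> (\<Sum>i. diam_gauge s (U i))"
    using U(1) s(1) st
    by (intro suminf_le diam_gauge_antimono_exponent) (auto simp: delta_cover_def)
  then show thesis
    using U by (intro that[of U]) (auto simp: delta_cover_def)
qed

text \<open>Packing by translation and scaling from a finite cover of one ball.\<close>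

lemma separated_sets_card_bounded:
  fixes B b :: real
  assumes "0 < b"
  obtains M :: nat where
    "\<And>(a :: 'a::euclidean_space) Z \<delta>. 0 < \<delta> \<Longrightarrow> Z \<subseteq> cball a (B * \<delta>) \<Longrightarrow>
      (\<And>x y. x \<in> Z \<Longrightarrow> y \<in> Z \<Longrightarrow> x \<noteq> y \<Longrightarrow> b * \<delta> \<le> dist x y) \<Longrightarrow> finite Z \<and> card Z \<le> M"
proof -
  obtain C where C: "finite C" "cball (0 :: 'a) B \<subseteq> (\<Union>c\<in>C. ball c (b / 2))"
    using compact_cball[of "0 :: 'a" B, unfolded compact_eq_totally_bounded] half_gt_zero[OF assms]
    by blast
  show thesis
  proof (rule that[of "card C"])
    fix a :: 'a and Z \<delta>
    assume \<delta>: "0 < (\<delta> :: real)" and Z: "Z \<subseteq> cball a (B * \<delta>)"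
      and sep: "\<And>x y. x \<in> Z \<Longrightarrow> y \<in> Z \<Longrightarrow> x \<noteq> y \<Longrightarrow> b * \<delta> \<le> dist x y"
    \<comment> \<open>Rescaling brings \<open>Z\<close> into the fixed ball of radius
      \<open>B\<close> about 0 with separation b; each covering ball of radius \<open>b / 2\<close>
      then holds at most one point.\<close>
    define h where "h z = (1 / \<delta>) *\<^sub>R (z - a)" for z
    have dist_h: "dist (h x) (h y) = dist x y / \<delta>" for x y
      using \<delta> by (simp add: h_def dist_norm flip: scaleR_diff_right)
    have "\<exists>c\<in>C. h z \<in> ball c (b / 2)" if "z \<in> Z" for z
    proof -
      have "norm (z - a) \<le> B * \<delta>"
        using Z that by (auto simp: dist_norm norm_minus_commute)
      then have "h z \<in> cball 0 B"
        using \<delta> by (simp add: h_def divide_le_eq)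
      then show ?thesis
        using C by blast
    qed
    then have "\<forall>z\<in>Z. \<exists>c. c \<in> C \<and> h z \<in> ball c (b / 2)"
      by blast
    from bchoice[OF this] obtain g where g: "\<forall>z\<in>Z. g z \<in> C \<and> h z \<in> ball (g z) (b / 2)"
      by blast
    have "inj_on g Z"
    proof (rule inj_onI, rule ccontr)
      fix x y assume xy: "x \<in> Z" "y \<in> Z" "g x = g y" "x \<noteq> y"
      have "dist (g x) (h x) < b / 2" "dist (g x) (h y) < b / 2"
        using bspec[OF g xy(1)] bspec[OF g xy(2)] unfolding xy(3) mem_ball by blast+
      then have "dist (h x) (h y) < b"
        using dist_triangle3[of "h x" "h y" "g x"] by linarith
      then show False
        using sep[OF xy(1,2,4)] \<delta> by (simp add: dist_h divide_less_eq)
    qed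
    moreover have "g ` Z \<subseteq> C"
      using g by blast
    ultimately show "finite Z \<and> card Z \<le> card C"
      using C(1) inj_on_finite[of g Z C] card_inj_on_le[of g Z C] by simp
  qed
qed

section \<open>Similarities and derivatives\<close>

text \<open>A similarity stretches all directions equally, so the difference quotients along a
  single segment in \<open>S\<close> from x already reveal its ratio.\<close>

lemma similarity_scale_le_lipschitz:
  fixes f :: "'v::euclidean_space \<Rightarrow> 'v"
  assumes der: "(f has_derivative (\<lambda>v. c *\<^sub>R T v)) (at x within S)" and T: "orthogonal_transformation T"
    and lip: "\<And>y. y \<in> S \<Longrightarrow> dist (f y) (f x) \<le> s * dist y x"
    and seg: "closed_segment x p \<subseteq> S" "x \<noteq> p"
  shows "c \<le> s"
proof (rule field_le_epsilon)
  fix e :: real assume e: "0 < e"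
  then obtain d where d: "0 < d"
    "\<And>y. y \<in> S \<Longrightarrow> norm (y - x) < d \<Longrightarrow> norm (f y - f x - c *\<^sub>R T (y - x)) \<le> e * norm (y - x)"
    using der unfolding has_derivative_within_alt by blast
  define h where "h = norm (p - x)"
  have h: "0 < h"
    using seg by (simp add: h_def)
  define t where "t = min 1 (d / (2 * h))"
  have t: "0 < t" "t \<le> 1"
    using d h by (auto simp: t_def)
  have "t * h \<le> d / (2 * h) * h"
    using h by (intro mult_right_mono) (auto simp: t_def)
  then have th: "t * h < d"
    using d h by simp
  define y where "y = x + t *\<^sub>R (p - x)"
  have "y = (1 - t) *\<^sub>R x + t *\<^sub>R p"
    by (simp add: y_def algebra_simps)
  then have "y \<in> closed_segment x p"
    using t unfolding in_segment by (intro exI[of _ t]) simp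
  then have y: "y \<in> S"
    using seg(1) by blast
  have yx: "y - x = t *\<^sub>R (p - x)" "norm (y - x) = t * h"
    using t by (auto simp: y_def h_def)
  have "c * (t * h) \<le> norm (c *\<^sub>R T (y - x))"
    using t h yx by (simp add: orthogonal_transformation_norm[OF T] mult_right_mono)
  also have "\<dots> \<le> norm (f y - f x) + norm (f y - f x - c *\<^sub>R T (y - x))"
    by (metis norm_triangle_ineq4 diff_diff_eq2 add_diff_cancel_left' diff_add_cancel)
  also have "\<dots> \<le> s * (t * h) + e * (t * h)"
    using d(2)[OF y] lip[OF y] th yx by (simp add: dist_norm)
  also have "\<dots> = (s + e) * (t * h)"
    by (simp add: algebra_simps)
  finally show "c \<le> s + e"
    using t h by (simp add: mult_le_cancel_right)
qed

lemma onorm_similarity: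
  fixes T :: "'v::euclidean_space \<Rightarrow> 'v"
  assumes "orthogonal_transformation T" "0 \<le> c"
  shows "onorm (\<lambda>v. c *\<^sub>R T v) = c"
proof (rule antisym)
  have lin: "bounded_linear (\<lambda>v. c *\<^sub>R T v)"
    using assms by (intro bounded_linear_scaleR_const linear_linear[THEN iffD2] bounded_linear_const_scaleR)
      (auto simp: orthogonal_transformation_linear linear_conv_bounded_linear[symmetric])
  show "onorm (\<lambda>v. c *\<^sub>R T v) \<le> c"
    by (rule onorm_le) (use assms in \<open>simp add: orthogonal_transformation_norm\<close>)
  obtain b :: 'v where b: "b \<in> Basis"
    using nonempty_Basis by blast
  have "norm (c *\<^sub>R T b) \<le> onorm (\<lambda>v. c *\<^sub>R T v) * norm b"
    by (rule onorm[OF lin])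
  then show "c \<le> onorm (\<lambda>v. c *\<^sub>R T v)"
    using assms b by (simp add: orthogonal_transformation_norm)
qed

lemma inv_similarity:
  fixes T :: "'v::euclidean_space \<Rightarrow> 'v"
  assumes "orthogonal_transformation T" "c \<noteq> 0"
  shows "inv (\<lambda>v. c *\<^sub>R T v) = (\<lambda>v. (1 / c) *\<^sub>R inv T v)"
proof (rule inv_equality)
  have lin: "linear T" "linear (inv T)"
    using assms by (auto intro: orthogonal_transformation_linear orthogonal_transformation_inv)
  show "(1 / c) *\<^sub>R inv T (c *\<^sub>R T x) = x" for x
    using assms orthogonal_transformation_inj[OF assms(1)] by (simp add: linear_scale[OF lin(2)])
  show "c *\<^sub>R T ((1 / c) *\<^sub>R inv T y) = y" for y
    using assms orthogonal_transformation_surj[OF assms(1)]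
    by (simp add: linear_scale[OF lin(1)] surj_f_inv_f)
qed

text \<open>On the largest ball inside the image, the inverse is \<open>1 / a\<close>-Lipschitz, and the ball reaches
  the image of the sphere; hence its radius is at least \<open>a * \<rho>\<close>.\<close>

lemma ball_subset_image_of_expanding:
  fixes f :: "'v::euclidean_space \<Rightarrow> 'v"
  assumes \<rho>: "0 < \<rho>" "\<rho> < c" and a: "0 < a"
    and cont: "continuous_on (ball p c) f" and inj: "inj_on f (ball p c)"
    and der: "\<And>x. x \<in> ball p c \<Longrightarrow> \<exists>k\<ge>a. \<exists>T. orthogonal_transformation T \<and> (f has_derivative (\<lambda>v. k *\<^sub>R T v)) (at x)"
  shows "ball (f p) (a * \<rho>) \<subseteq> f ` ball p c"
proof -
  have sub: "cball p \<rho> \<subseteq> ball p c" "ball p \<rho> \<subseteq> ball p c" "sphere p \<rho> \<subseteq> ball p c" "p \<in> ball p c" "p \<in> ball p \<rho>"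
    using \<rho> by auto
  have "continuous_on (sphere p \<rho>) (\<lambda>z. dist (f z) (f p))"
    by (intro continuous_intros continuous_on_subset[OF cont] sub)
  then obtain z0 where z0: "z0 \<in> sphere p \<rho>" "\<And>z. z \<in> sphere p \<rho> \<Longrightarrow> dist (f z0) (f p) \<le> dist (f z) (f p)"
    using continuous_attains_inf[of "sphere p \<rho>" "\<lambda>z. dist (f z) (f p)"] \<rho> by auto
  define r0 where "r0 = dist (f z0) (f p)"
  have "z0 \<noteq> p"
    using z0 \<rho> by auto
  then have "f z0 \<noteq> f p"
    using inj z0(1) sub by (meson inj_onD subsetD)
  then have r0: "0 < r0"
    by (simp add: r0_def)
  have ball: "ball (f p) r0 \<subseteq> f ` ball p \<rho>"
  proof (rule ball_subset_open_map_image)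
    show "continuous_on (closure (ball p \<rho>)) f"
      using \<rho> sub by (auto intro: continuous_on_subset[OF cont])
    show "open (f ` interior (ball p \<rho>))"
      using sub by (intro invariance_of_domain) (auto intro: continuous_on_subset[OF cont] inj_on_subset[OF inj])
    show "r0 \<le> norm (f z - f p)" if "z \<in> frontier (ball p \<rho>)" for z
      using z0(2)[of z] that \<rho> by (simp add: r0_def dist_norm)
  qed (use \<rho> r0 in auto)
  define g where "g = inv_into (ball p c) f"
  have gf: "g (f x) = x" if "x \<in> ball p c" for x
    using inj that by (simp add: g_def)
  have contg: "continuous_on (f ` ball p c) g"
    by (rule continuous_on_inverse_open) (use cont gf in auto)
  have fg: "f (g y) = y" "g y \<in> ball p c" if "y \<in> f ` ball p c" for y
    using that gf by auto
  have open_im: "open (f ` ball p c)"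
    using cont inj by (intro invariance_of_domain) auto
  have derg: "\<exists>g'. (g has_derivative g') (at y) \<and> onorm g' \<le> 1 / a" if y: "y \<in> f ` ball p c" for y
  proof -
    obtain k T where k: "a \<le> k" and T: "orthogonal_transformation T"
      and d: "(f has_derivative (\<lambda>v. k *\<^sub>R T v)) (at (g y))"
      using der[OF fg(2)[OF y]] by blast
    have k0: "0 < k"
      using a k by simp
    have lin: "linear (inv T)"
      using T by (intro orthogonal_transformation_linear orthogonal_transformation_inv)
    have "(g has_derivative (\<lambda>v. (1 / k) *\<^sub>R inv T v)) (at y)"
    proof (rule has_derivative_inverse_basic[where f = f and g = g and y = y and T = "f ` ball p c"])
      show "bounded_linear (\<lambda>v. (1 / k) *\<^sub>R inv T v)"
        using lin by (intro bounded_linear_const_scaleR) (simp add: linear_conv_bounded_linear)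
      show "(\<lambda>v. (1 / k) *\<^sub>R inv T v) \<circ> (\<lambda>v. k *\<^sub>R T v) = id"
        using k0 orthogonal_transformation_inj[OF T] by (auto simp: linear_scale[OF lin])
      show "continuous (at y) g"
        using contg open_im y continuous_on_eq_continuous_at by blast
    qed (use d open_im y fg in auto)
    moreover have "onorm (\<lambda>v. (1 / k) *\<^sub>R inv T v) \<le> 1 / a"
      using onorm_similarity[OF orthogonal_transformation_inv[OF T], of "1 / k"] k k0 a
      by (simp add: frac_le)
    ultimately show ?thesis
      by blast
  qed
  then obtain g' where g': "\<And>y. y \<in> f ` ball p c \<Longrightarrow> (g has_derivative g' y) (at y) \<and> onorm (g' y) \<le> 1 / a"
    by metis
  \<comment> \<open>The mean value inequality for g is applied on this ball because the ball is
    convex; the whole image need not be.\<close>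
  have lipg: "norm (g y - p) - 1 / a * norm (y - f p) \<le> 0" if y: "y \<in> ball (f p) r0" for y
  proof -
    have sub': "ball (f p) r0 \<subseteq> f ` ball p c"
      using ball sub by blast
    have "norm (g y - g (f p)) \<le> 1 / a * norm (y - f p)"
    proof (rule differentiable_bound[OF convex_ball])
      show "(g has_derivative g' x) (at x within ball (f p) r0)" "onorm (g' x) \<le> 1 / a"
        if "x \<in> ball (f p) r0" for x
        using g'[OF subsetD[OF sub' that]] by (blast intro: has_derivative_at_withinI)+
    qed (use y r0 in auto)
    then show ?thesis
      using gf[OF sub(4)] by simp
  qed
  have cl: "closure (ball (f p) r0) \<subseteq> f ` ball p c"
  proof -
    have "compact (f ` cball p \<rho>)"
      by (intro compact_continuous_image continuous_on_subset[OF cont] sub) simp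
    then have "closed (f ` cball p \<rho>)"
      by (rule compact_imp_closed)
    moreover have "ball (f p) r0 \<subseteq> f ` cball p \<rho>"
      using ball ball_subset_cball by blast
    ultimately have "closure (ball (f p) r0) \<subseteq> f ` cball p \<rho>"
      by (rule closure_minimal[rotated])
    then show ?thesis
      using sub by blast
  qed
  have "norm (g (f z0) - p) - 1 / a * norm (f z0 - f p) \<le> 0"
  proof (rule continuous_le_on_closure[OF _ _ lipg])
    show "continuous_on (closure (ball (f p) r0)) (\<lambda>y. norm (g y - p) - 1 / a * norm (y - f p))"
      by (intro continuous_intros continuous_on_subset[OF contg cl])
    show "f z0 \<in> closure (ball (f p) r0)"
      using r0 by (simp add: r0_def dist_commute)
  qed
  moreover have "g (f z0) = z0"
    using z0(1) sub by (intro gf) auto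
  ultimately have "\<rho> \<le> 1 / a * r0"
    using z0(1) by (simp add: r0_def dist_norm norm_minus_commute)
  then have "a * \<rho> \<le> r0"
    using a by (simp add: field_simps)
  then show ?thesis
    using ball sub by (meson order_trans subset_ball image_mono)
qed

section \<open>Iterated function systems with bounded distortion\<close>

text \<open>The scale \<open>\<rho> e x\<close> stands for \<open>|\<phi>\<^sub>e'(x)|\<close>, controlled on \<open>Y\<close> only. The points \<open>p\<close> of \<open>center\<close>
  come from the cone property: \<open>Y\<close> need not be locally convex or rectifiably connected, but from
  every point of \<open>Y\<close> a segment of fixed length leads to the centre of a ball of fixed radius.\<close>

locale scaled_ifs =
  fixes A :: "'e set" and Y :: "'v::euclidean_space set" and \<phi> :: "'e \<Rightarrow> 'v \<Rightarrow> 'v"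
    and \<rho> :: "'e \<Rightarrow> 'v \<Rightarrow> real" and L \<alpha> s h c :: real
  assumes finite_A: "finite A" and A_nonempty: "A \<noteq> {}"
    and compact_Y: "compact Y" and Y_nonempty: "Y \<noteq> {}"
    and maps_to: "\<And>e. e \<in> A \<Longrightarrow> \<phi> e ` Y \<subseteq> Y"
    and injective: "\<And>e. e \<in> A \<Longrightarrow> inj_on (\<phi> e) Y"
    and open_set_condition:
      "\<And>e f. e \<in> A \<Longrightarrow> f \<in> A \<Longrightarrow> e \<noteq> f \<Longrightarrow> \<phi> e ` interior Y \<inter> \<phi> f ` interior Y = {}"
    and s: "0 < s" "s < 1"
    and lipschitz: "\<And>e. e \<in> A \<Longrightarrow> s-lipschitz_on Y (\<phi> e)"
    and scale_pos: "\<And>e x. e \<in> A \<Longrightarrow> x \<in> Y \<Longrightarrow> 0 < \<rho> e x"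
    and derivative: "\<And>e x. e \<in> A \<Longrightarrow> x \<in> Y \<Longrightarrow>
      \<exists>T. orthogonal_transformation T \<and> (\<phi> e has_derivative (\<lambda>v. \<rho> e x *\<^sub>R T v)) (at x within Y)"
    and hoelder: "\<And>e x y. e \<in> A \<Longrightarrow> x \<in> Y \<Longrightarrow> y \<in> Y \<Longrightarrow> \<rho> e x \<le> \<rho> e y * (1 + L * dist x y powr \<alpha>)"
    and L: "0 \<le> L" and \<alpha>: "0 < \<alpha>"
    and h: "0 < h" and c: "0 < c"
    and center: "\<And>x. x \<in> Y \<Longrightarrow> \<exists>p. closed_segment x p \<subseteq> Y \<and> dist x p = h \<and> ball p c \<subseteq> Y"
begin

section \<open>Compositions along words, the chain rule and bounded distortion\<close>

lemma scale_le:
  assumes "e \<in> A" "x \<in> Y"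
  shows "\<rho> e x \<le> s"
proof -
  obtain T where T: "orthogonal_transformation T" "(\<phi> e has_derivative (\<lambda>v. \<rho> e x *\<^sub>R T v)) (at x within Y)"
    using derivative[OF assms] by blast
  obtain p where p: "closed_segment x p \<subseteq> Y" "dist x p = h"
    using center[OF assms(2)] by blast
  show ?thesis
    by (rule similarity_scale_le_lipschitz[OF T(2,1) _ p(1)])
       (use lipschitz_onD[OF lipschitz[OF assms(1)]] assms p h in auto)
qed

text \<open>Letters are peeled off at the outer end, opposite to \<open>word_map\<close>, so that an
  induction on the list composes one more map on the outside.\<close>

primrec wmap :: "'e list \<Rightarrow> 'v \<Rightarrow> 'v" where
  "wmap [] = id"
| "wmap (e # w) = \<phi> e \<circ> wmap w"

text \<open>The chain-rule product along the orbit of x; by \<open>wmap_derivative\<close> it is the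
  ratio of the derivative of \<open>wmap w\<close> at x.\<close>

primrec wscale :: "'e list \<Rightarrow> 'v \<Rightarrow> real" where
  "wscale [] x = 1"
| "wscale (e # w) x = \<rho> e (wmap w x) * wscale w x"

lemma wmap_append: "wmap (u @ v) = wmap u \<circ> wmap v"
  by (induction u) (auto simp: o_assoc)

lemma wscale_append: "wscale (u @ v) x = wscale u (wmap v x) * wscale v x"
  by (induction u) (auto simp: wmap_append)

lemma word_map_eq_wmap: "word_map \<phi> \<omega> n = wmap (pref \<omega> n)"
  by (induction n) (auto simp: pref_Suc wmap_append)

lemma wmap_in_Y: "w \<in> lists A \<Longrightarrow> x \<in> Y \<Longrightarrow> wmap w x \<in> Y"
  using maps_to by (induction w) auto

lemma inj_on_wmap: "w \<in> lists A \<Longrightarrow> inj_on (wmap w) Y"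
proof (induction w)
  case (Cons e w)
  have "inj_on (\<phi> e \<circ> wmap w) Y"
  proof (rule comp_inj_on)
    show "inj_on (\<phi> e) (wmap w ` Y)"
      using Cons wmap_in_Y[of w] by (intro inj_on_subset[OF injective]) auto
  qed (use Cons in auto)
  then show ?case
    by (simp add: comp_def)
qed simp

lemma wscale_pos: "w \<in> lists A \<Longrightarrow> x \<in> Y \<Longrightarrow> 0 < wscale w x"
  by (induction w) (auto intro!: mult_pos_pos scale_pos wmap_in_Y)

lemma wscale_le: "w \<in> lists A \<Longrightarrow> x \<in> Y \<Longrightarrow> wscale w x \<le> s ^ length w"
proof (induction w)
  case (Cons e w)
  then show ?case
    using scale_le[of e "wmap w x"] wmap_in_Y[of w x] wscale_pos[of w x] s
    by (auto intro!: mult_mono)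
qed simp

lemma wmap_lipschitz:
  "w \<in> lists A \<Longrightarrow> x \<in> Y \<Longrightarrow> y \<in> Y \<Longrightarrow> dist (wmap w x) (wmap w y) \<le> s ^ length w * dist x y"
proof (induction w)
  case (Cons e w)
  then have "dist (wmap (e # w) x) (wmap (e # w) y) \<le> s * dist (wmap w x) (wmap w y)"
    using lipschitz_onD[OF lipschitz[of e]] wmap_in_Y[of w] by auto
  also have "\<dots> \<le> s * (s ^ length w * dist x y)"
    using Cons s by (intro mult_left_mono) auto
  finally show ?case
    by simp
qed simp

lemma continuous_on_wmap: "w \<in> lists A \<Longrightarrow> continuous_on Y (wmap w)"
  using wmap_lipschitz[of w] s
  by (intro lipschitz_on_continuous_on[where L = "s ^ length w"] lipschitz_onI) auto

lemma wmap_derivative: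
  assumes "w \<in> lists A" "x \<in> Y"
  shows "\<exists>T. orthogonal_transformation T \<and> (wmap w has_derivative (\<lambda>v. wscale w x *\<^sub>R T v)) (at x within Y)"
  using assms(1)
proof (induction w)
  case Nil
  show ?case
    by (intro exI[of _ "\<lambda>v. v"]) (auto simp: id_def)
next
  case (Cons e w)
  then obtain T where T: "orthogonal_transformation T" "(wmap w has_derivative (\<lambda>v. wscale w x *\<^sub>R T v)) (at x within Y)"
    by auto
  have wx: "wmap w x \<in> Y" "wmap w ` Y \<subseteq> Y" "e \<in> A"
    using wmap_in_Y[of w] Cons assms(2) by auto
  then obtain T' where T': "orthogonal_transformation T'"
    "(\<phi> e has_derivative (\<lambda>v. \<rho> e (wmap w x) *\<^sub>R T' v)) (at (wmap w x) within Y)"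
    using derivative by blast
  have "((\<lambda>y. \<phi> e (wmap w y)) has_derivative (\<lambda>v. \<rho> e (wmap w x) *\<^sub>R T' (wscale w x *\<^sub>R T v))) (at x within Y)"
    by (rule has_derivative_in_compose[OF T(2) has_derivative_subset[OF T'(2) wx(2)]])
  moreover have "\<rho> e (wmap w x) *\<^sub>R T' (wscale w x *\<^sub>R T v) = wscale (e # w) x *\<^sub>R (T' \<circ> T) v" for v
    by (simp add: orthogonal_transformation_scaleR[OF T'(1)])
  ultimately show ?case
    using orthogonal_transformation_compose[OF T'(1) T(1)] by (auto simp: o_def)
qed

text \<open>Passing from x to y changes the outermost factor by at most 1 plus \<open>L\<close>
  times a power of the distance of the images under the inner word. These are within
  \<open>s ^ length w * diameter Y\<close>, so the logarithms of all factors add up to a geometric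
  sum.\<close>

lemma wscale_distortion:
  assumes "w \<in> lists A" "x \<in> Y" "y \<in> Y"
  shows "wscale w x \<le> exp (L * diameter Y powr \<alpha> * (\<Sum>i<length w. (s powr \<alpha>) ^ i)) * wscale w y"
  using assms(1)
proof (induction w)
  case (Cons e w)
  define D where "D = diameter Y powr \<alpha>"
  have w: "w \<in> lists A" "e \<in> A" "wmap w x \<in> Y" "wmap w y \<in> Y"
    using Cons assms wmap_in_Y by auto
  have "dist x y \<le> diameter Y"
    using assms compact_imp_bounded[OF compact_Y] by (intro diameter_bounded_bound)
  then have "dist (wmap w x) (wmap w y) \<le> s ^ length w * diameter Y"
    using wmap_lipschitz[OF w(1) assms(2,3)] s by (auto intro: order_trans mult_left_mono)
  then have "dist (wmap w x) (wmap w y) powr \<alpha> \<le> (s ^ length w * diameter Y) powr \<alpha>"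
    using \<alpha> by (intro powr_mono2) auto
  also have "\<dots> = (s powr \<alpha>) ^ length w * D"
    using s compact_imp_bounded[OF compact_Y]
    by (simp add: D_def powr_mult diameter_ge_0 powr_realpow[symmetric] powr_powr mult.commute)
  finally have d: "L * dist (wmap w x) (wmap w y) powr \<alpha> \<le> L * D * (s powr \<alpha>) ^ length w"
    using L by (simp add: mult_left_mono mult.assoc mult.commute[of D])
  have "\<rho> e (wmap w x) \<le> \<rho> e (wmap w y) * (1 + L * dist (wmap w x) (wmap w y) powr \<alpha>)"
    by (rule hoelder[OF w(2-4)])
  also have "\<dots> \<le> \<rho> e (wmap w y) * exp (L * D * (s powr \<alpha>) ^ length w)"
  proof (rule mult_left_mono)
    have "1 + L * dist (wmap w x) (wmap w y) powr \<alpha> \<le> 1 + L * D * (s powr \<alpha>) ^ length w"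
      using d by simp
    also have "\<dots> \<le> exp (L * D * (s powr \<alpha>) ^ length w)"
      by (rule exp_ge_add_one_self)
    finally show "1 + L * dist (wmap w x) (wmap w y) powr \<alpha> \<le> exp (L * D * (s powr \<alpha>) ^ length w)" .
  qed (use scale_pos[OF w(2,4)] in simp)
  finally have 1: "\<rho> e (wmap w x) \<le> \<rho> e (wmap w y) * exp (L * D * (s powr \<alpha>) ^ length w)" .
  have "wscale (e # w) x \<le> (\<rho> e (wmap w y) * exp (L * D * (s powr \<alpha>) ^ length w))
      * (exp (L * D * (\<Sum>i<length w. (s powr \<alpha>) ^ i)) * wscale w y)"
    using 1 Cons scale_pos[OF w(2,4)] wscale_pos[OF w(1) assms(2)] unfolding D_def wscale.simps
    by (intro mult_mono) auto
  also have "\<dots> = exp (L * D * (\<Sum>i<length (e # w). (s powr \<alpha>) ^ i)) * wscale (e # w) y"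
    by (simp add: exp_add distrib_left)
  finally show ?case
    by (simp add: D_def)
qed simp

text \<open>The full geometric series replaces the finite sum of \<open>wscale_distortion\<close>,
  so that one constant serves words of every length.\<close>

definition K :: real where
  "K = exp (L * diameter Y powr \<alpha> / (1 - s powr \<alpha>))"

lemma K_ge_1: "1 \<le> K"
proof -
  have "s powr \<alpha> < 1"
    using s \<alpha> powr_less_mono2[of \<alpha> s 1] by simp
  then show ?thesis
    using L by (simp add: K_def)
qed

lemma wscale_le_K:
  assumes "w \<in> lists A" "x \<in> Y" "y \<in> Y"
  shows "wscale w x \<le> K * wscale w y"
proof -
  have sa: "0 \<le> s powr \<alpha>" "s powr \<alpha> < 1"
    using s \<alpha> powr_less_mono2[of \<alpha> s 1] by auto
  have "(\<Sum>i<length w. (s powr \<alpha>) ^ i) = (1 - (s powr \<alpha>) ^ length w) / (1 - s powr \<alpha>)"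
    using sa by (simp add: sum_gp_strict)
  also have "\<dots> \<le> 1 / (1 - s powr \<alpha>)"
    using sa by (intro divide_right_mono) auto
  finally have "L * diameter Y powr \<alpha> * (\<Sum>i<length w. (s powr \<alpha>) ^ i) \<le> L * diameter Y powr \<alpha> * (1 / (1 - s powr \<alpha>))"
    using L by (intro mult_left_mono) auto
  then have "exp (L * diameter Y powr \<alpha> * (\<Sum>i<length w. (s powr \<alpha>) ^ i)) \<le> K"
    by (simp add: K_def)
  then have "exp (L * diameter Y powr \<alpha> * (\<Sum>i<length w. (s powr \<alpha>) ^ i)) * wscale w y \<le> K * wscale w y"
    using wscale_pos[OF assms(1,3)] by (intro mult_right_mono) auto
  with wscale_distortion[OF assms] show ?thesis
    by (rule order_trans)
qed

definition base :: 'v where "base = (SOME x. x \<in> Y)"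

lemma base_in_Y: "base \<in> Y"
  unfolding base_def using Y_nonempty by (simp add: some_in_eq)

text \<open>The factor \<open>K\<close> makes the weight an upper bound for the scale at every point and submultiplicative.\<close>

definition r :: "'e list \<Rightarrow> real" where "r w = K * wscale w base"

lemma r_Nil: "r [] = K"
  by (simp add: r_def)

lemma wscale_le_r: "w \<in> lists A \<Longrightarrow> x \<in> Y \<Longrightarrow> wscale w x \<le> r w"
  unfolding r_def using base_in_Y by (intro wscale_le_K)

lemma r_le_wscale: "w \<in> lists A \<Longrightarrow> x \<in> Y \<Longrightarrow> r w / K\<^sup>2 \<le> wscale w x"
  using wscale_le_K[of w base x] base_in_Y K_ge_1
  by (simp add: r_def power2_eq_square pos_divide_le_eq mult.commute)

text \<open>Moving the evaluation point of the left factor costs one \<open>K\<close>. In the upper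
  bound it is absorbed by the second \<open>K\<close> contained in \<open>r u * r v\<close>; in the
  lower bound both accumulate, whence \<open>1 / K\<^sup>2\<close>.\<close>

sublocale word_weights A r K "1 / K\<^sup>2" s
proof
  show "0 < K" "0 < 1 / K\<^sup>2"
    using K_ge_1 by auto
  show "0 < r w" if "w \<in> lists A" for w
    using wscale_pos[OF that base_in_Y] K_ge_1 by (simp add: r_def)
  show "r w \<le> K * s ^ length w" if "w \<in> lists A" for w
    using wscale_le[OF that base_in_Y] K_ge_1 by (simp add: r_def)
  fix u v assume uv: "u \<in> lists A" "v \<in> lists A"
  have vb: "wmap v base \<in> Y"
    using uv base_in_Y by (intro wmap_in_Y)
  have pos: "0 < wscale v base" "0 < wscale u base"
    using uv base_in_Y by (auto intro: wscale_pos)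
  have "K * (wscale u (wmap v base) * wscale v base) \<le> K * (K * wscale u base * wscale v base)"
    using wscale_le_K[OF uv(1) vb base_in_Y] K_ge_1 pos by (intro mult_left_mono mult_right_mono) auto
  then show "r (u @ v) \<le> r u * r v"
    by (simp add: r_def wscale_append ac_simps)
  have "wscale u base * wscale v base \<le> K * wscale u (wmap v base) * wscale v base"
    using wscale_le_K[OF uv(1) base_in_Y vb] pos by (intro mult_right_mono) auto
  then show "1 / K\<^sup>2 * (r u * r v) \<le> r (u @ v)"
    using K_ge_1 by (simp add: r_def wscale_append power2_eq_square ac_simps)
qed (use finite_A A_nonempty s in auto)

section \<open>Sizes of images, inner balls and disjointness\<close>

lemma wmap_segment:
  assumes w: "w \<in> lists A" and seg: "closed_segment x y \<subseteq> Y"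
  shows "dist (wmap w x) (wmap w y) \<le> r w * dist x y"
proof -
  obtain T where T: "\<And>z. z \<in> Y \<Longrightarrow> orthogonal_transformation (T z)"
    "\<And>z. z \<in> Y \<Longrightarrow> (wmap w has_derivative (\<lambda>v. wscale w z *\<^sub>R T z v)) (at z within Y)"
    using wmap_derivative[OF w] by metis
  have "norm (wmap w x - wmap w y) \<le> r w * norm (x - y)"
  proof (rule differentiable_bound[OF convex_closed_segment])
    fix z assume "z \<in> closed_segment x y"
    then have z: "z \<in> Y"
      using seg by blast
    show "(wmap w has_derivative (\<lambda>v. wscale w z *\<^sub>R T z v)) (at z within closed_segment x y)"
      by (rule has_derivative_subset[OF T(2)[OF z] seg])
    show "onorm (\<lambda>v. wscale w z *\<^sub>R T z v) \<le> r w"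
      using onorm_similarity[OF T(1)[OF z], of "wscale w z"] wscale_pos[OF w z] wscale_le_r[OF w z] by simp
  qed auto
  then show ?thesis
    by (simp add: dist_norm)
qed

text \<open>The expansion bound \<open>r w / K\<^sup>2\<close> times a radius \<open>c / 2\<close>
  strictly inside \<open>ball p c\<close>, with \<open>r w\<close> taken out.\<close>

definition \<kappa> :: real where "\<kappa> = c / (2 * K\<^sup>2)"

lemma \<kappa>_pos: "0 < \<kappa>"
  using c K_ge_1 by (simp add: \<kappa>_def)

lemma ball_subset_wmap_ball:
  assumes w: "w \<in> lists A" and p: "ball p c \<subseteq> Y"
  shows "ball (wmap w p) (\<kappa> * r w) \<subseteq> wmap w ` ball p c"
proof -
  have "ball (wmap w p) (r w / K\<^sup>2 * (c / 2)) \<subseteq> wmap w ` ball p c"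
  proof (rule ball_subset_image_of_expanding)
    show "continuous_on (ball p c) (wmap w)" "inj_on (wmap w) (ball p c)"
      using continuous_on_wmap[OF w] inj_on_wmap[OF w] p by (auto intro: continuous_on_subset inj_on_subset)
    show "0 < r w / K\<^sup>2"
      using r_pos[OF w] K_ge_1 by simp
    fix x assume x: "x \<in> ball p c"
    then obtain T where T: "orthogonal_transformation T" "(wmap w has_derivative (\<lambda>v. wscale w x *\<^sub>R T v)) (at x within Y)"
      using wmap_derivative[OF w] p by blast
    have "x \<in> interior Y"
      using x p by (meson interior_maximal open_ball subsetD)
    then have "at x within Y = at x"
      by (rule at_within_interior)
    then show "\<exists>k\<ge>r w / K\<^sup>2. \<exists>T. orthogonal_transformation T \<and> (wmap w has_derivative (\<lambda>v. k *\<^sub>R T v)) (at x)"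
      using T r_le_wscale[OF w, of x] subsetD[OF p x] by auto
  qed (use c in auto)
  moreover have "r w / K\<^sup>2 * (c / 2) = \<kappa> * r w"
    by (simp add: \<kappa>_def ac_simps)
  ultimately show ?thesis
    by simp
qed

lemma wmap_interior: "w \<in> lists A \<Longrightarrow> wmap w ` interior Y \<subseteq> interior Y"
proof (rule interior_maximal)
  assume w: "w \<in> lists A"
  show "wmap w ` interior Y \<subseteq> Y"
    using wmap_in_Y[OF w] interior_subset by blast
  show "open (wmap w ` interior Y)"
    using continuous_on_wmap[OF w] inj_on_wmap[OF w] interior_subset[of Y]
    by (intro invariance_of_domain) (auto intro: continuous_on_subset inj_on_subset)
qed

text \<open>Injectivity strips common first letters. Words without a common extension must differ at
  some letter, where the open set condition applies, since \<open>wmap_interior\<close> keeps the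
  inner images inside \<open>interior Y\<close>.\<close>

lemma wmap_interior_disjoint:
  assumes "u \<in> lists A" "v \<in> lists A" "\<forall>p q. u @ p \<noteq> v @ q"
  shows "wmap u ` interior Y \<inter> wmap v ` interior Y = {}"
  using assms
proof (induction u arbitrary: v)
  case Nil
  then show ?case
    by (metis append_Nil append_Nil2)
next
  case (Cons e u)
  show ?case
  proof (cases v)
    case Nil
    then show ?thesis
      using Cons.prems(2) by auto
  next
    case v: (Cons f v')
    then have A: "e \<in> A" "f \<in> A" "u \<in> lists A" "v' \<in> lists A"
      using Cons.prems Cons.hyps by auto
    show ?thesis
    proof (cases "e = f")
      case False
      have "wmap (e # u) ` interior Y \<subseteq> \<phi> e ` interior Y" "wmap v ` interior Y \<subseteq> \<phi> f ` interior Y"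
        using wmap_interior[OF A(3)] wmap_interior[OF A(4)] by (auto simp: v)
      then show ?thesis
        using open_set_condition[OF A(1,2) False] by blast
    next
      case True
      have "wmap u ` interior Y \<inter> wmap v' ` interior Y = {}"
        using Cons.prems(2) v True A by (intro Cons.IH) auto
      moreover have "wmap u ` interior Y \<union> wmap v' ` interior Y \<subseteq> Y"
        using wmap_in_Y[OF A(3)] wmap_in_Y[OF A(4)] interior_subset by blast
      ultimately have "\<phi> e ` (wmap u ` interior Y) \<inter> \<phi> e ` (wmap v' ` interior Y) = {}"
        using inj_on_image_Int[OF injective[OF A(1)], of "wmap u ` interior Y" "wmap v' ` interior Y"] by auto
      then show ?thesis
        by (simp add: v True image_comp)
    qed
  qed
qed

text \<open>\<open>coding_map\<close> is a \<open>the_elem\<close>, so the intersection must be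
  shown to be a singleton: nested compact sets give a point, contraction its uniqueness.\<close>

lemma coding_map_in_wmap:
  assumes "\<omega> \<in> full_shift A"
  shows "coding_map \<phi> Y \<omega> \<in> wmap (pref \<omega> n) ` Y"
proof -
  define F where "F n = wmap (pref \<omega> n) ` Y" for n
  have lists: "pref \<omega> n \<in> lists A" for n
    by (rule pref_in_lists[OF assms])
  have dec: "F n \<subseteq> F m" if "m \<le> n" for m n
  proof -
    have "pref \<omega> n = pref \<omega> m @ pref ((shift ^^ m) \<omega>) (n - m)"
      using pref_add[of \<omega> m "n - m"] that by simp
    moreover have "pref ((shift ^^ m) \<omega>) (n - m) \<in> lists A"
      using assms by (intro pref_in_lists funpow_shift_in_full)
    ultimately show ?thesis
      using wmap_in_Y by (auto simp: F_def wmap_append)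
  qed
  have "\<Inter> (range F) \<noteq> {}"
  proof (rule compact_nest)
    show "compact (F n)" for n
      unfolding F_def using compact_Y lists by (intro compact_continuous_image continuous_on_wmap)
    show "F n \<noteq> {}" for n
      using Y_nonempty by (simp add: F_def)
  qed (rule dec)
  then obtain z where z: "\<And>n. z \<in> F n"
    by blast
  have eq: "y = z" if y: "\<And>n. y \<in> F n" for y
  proof -
    have le: "dist y z \<le> diameter Y * s ^ n" for n
    proof -
      obtain a b where ab: "a \<in> Y" "b \<in> Y" "y = wmap (pref \<omega> n) a" "z = wmap (pref \<omega> n) b"
        using y[of n] z[of n] by (auto simp: F_def)
      have "dist y z \<le> s ^ n * dist a b"
        using wmap_lipschitz[OF lists[of n] ab(1,2)] ab(3,4) by simp
      also have "\<dots> \<le> s ^ n * diameter Y"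
        using diameter_bounded_bound[OF compact_imp_bounded[OF compact_Y] ab(1,2)] s
        by (intro mult_left_mono) auto
      finally show ?thesis
        by (simp add: mult.commute)
    qed
    have "(\<lambda>n. diameter Y * s ^ n) \<longlonglongrightarrow> diameter Y * 0"
      using s by (intro tendsto_mult_left LIMSEQ_realpow_zero) auto
    then have "dist y z \<le> diameter Y * 0"
      by (rule LIMSEQ_le_const) (use le in blast)
    then show ?thesis
      by simp
  qed
  have "(\<Inter>n\<in>{1..}. word_map \<phi> \<omega> n ` Y) = {z}"
  proof (intro equalityI subsetI)
    fix y assume y: "y \<in> (\<Inter>n\<in>{1..}. word_map \<phi> \<omega> n ` Y)"
    have "y \<in> F n" for n
    proof -
      \<comment> \<open>The intersection starts at index 1; the set \<open>F 0\<close> is reached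
        because the sets decrease.\<close>
      have "y \<in> F (Suc n)"
        using y by (auto simp: F_def word_map_eq_wmap)
      then show ?thesis
        using dec[of n "Suc n"] by auto
    qed
    then show "y \<in> {z}"
      using eq by blast
  qed (use z in \<open>auto simp: F_def word_map_eq_wmap\<close>)
  then have "coding_map \<phi> Y \<omega> = z"
    by (simp add: coding_map_def)
  then show ?thesis
    using z[of n] by (simp add: F_def)
qed

text \<open>Points of \<open>Y\<close> need not be joined by a segment in \<open>Y\<close>, so they
  are grouped by the location of \<open>p x\<close>. Within a group the broken line from x through
  \<open>p x\<close> and \<open>p y\<close> to y lies in \<open>Y\<close> and has length at most
  \<open>2 * h + c\<close>.\<close>

lemma pieces:
  obtains \<P> C where "finite \<P>" "\<Union>\<P> = Y" "0 < C"
    "\<And>w P x y. w \<in> lists A \<Longrightarrow> P \<in> \<P> \<Longrightarrow> x \<in> P \<Longrightarrow> y \<in> P \<Longrightarrow> dist (wmap w x) (wmap w y) \<le> C * r w"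
proof -
  obtain p where p: "\<And>x. x \<in> Y \<Longrightarrow> closed_segment x (p x) \<subseteq> Y \<and> dist x (p x) = h \<and> ball (p x) c \<subseteq> Y"
    using center by metis
  obtain Q where Q: "finite Q" "Y \<subseteq> (\<Union>z\<in>Q. ball z (c / 2))"
    using compact_Y[unfolded compact_eq_totally_bounded] half_gt_zero[OF c] by blast
  define P where "P z = {x \<in> Y. p x \<in> ball z (c / 2)}" for z
  show thesis
  proof (rule that[of "P ` Q" "2 * h + c"])
    show "\<Union> (P ` Q) = Y"
    proof (intro equalityI subsetI)
      fix x assume x: "x \<in> Y"
      then have "p x \<in> Y"
        using p by (meson ends_in_segment(2) subsetD)
      then show "x \<in> \<Union> (P ` Q)"
        using x Q(2) unfolding P_def by blast
    qed (auto simp: P_def)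
    fix w S x y assume w: "w \<in> lists A" and S: "S \<in> P ` Q" "x \<in> S" "y \<in> S"
    then obtain z where xy: "x \<in> Y" "y \<in> Y" "p x \<in> ball z (c / 2)" "p y \<in> ball z (c / 2)"
      by (auto simp: P_def)
    then have pq: "dist (p x) (p y) < c"
      using dist_triangle3[of "p x" "p y" z] by (simp only: mem_ball)
    then have "closed_segment (p x) (p y) \<subseteq> ball (p x) c"
      using c by (intro closed_segment_subset convex_ball) auto
    then have seg: "closed_segment (p x) (p y) \<subseteq> Y"
      using p[OF xy(1)] by blast
    have "dist (wmap w x) (wmap w (p x)) \<le> r w * h" "dist (wmap w y) (wmap w (p y)) \<le> r w * h"
      using wmap_segment[OF w] p[OF xy(1)] p[OF xy(2)] by metis+
    moreover have "dist (wmap w (p x)) (wmap w (p y)) \<le> r w * c"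
    proof -
      have "dist (wmap w (p x)) (wmap w (p y)) \<le> r w * dist (p x) (p y)"
        by (rule wmap_segment[OF w seg])
      also have "\<dots> \<le> r w * c"
        using pq r_pos[OF w] by (intro mult_left_mono) auto
      finally show ?thesis .
    qed
    moreover have "dist (wmap w x) (wmap w y) \<le> dist (wmap w x) (wmap w (p x))
        + dist (wmap w (p x)) (wmap w (p y)) + dist (wmap w y) (wmap w (p y))"
      by (smt (verit) dist_triangle dist_commute)
    ultimately show "dist (wmap w x) (wmap w y) \<le> (2 * h + c) * r w"
      by (simp add: algebra_simps)
  qed (use Q h c in auto)
qed

section \<open>Hausdorff dimension as critical exponent\<close>

text \<open>The images of the pieces under the n-th power of \<open>W\<close> cover the limit set;
  their diameters decay like \<open>s ^ n\<close> and their gauges sum to a multiple of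
  \<open>weight t W ^ n\<close>.\<close>

lemma hausdorff_dim_le_of_cover:
  assumes X: "subshift A X" and t: "0 < t"
    and W: "finite W" "W \<subseteq> lists A" "[] \<notin> W" "covered_by X W" "weight t W < 1"
  shows "hausdorff_dim (limit_set \<phi> Y X) \<le> ennreal t"
proof (rule hausdorff_dim_leI)
  fix \<delta> \<epsilon> :: real assume \<delta>: "0 < \<delta>" and \<epsilon>: "0 < \<epsilon>"
  obtain \<P> C where P: "finite \<P>" "\<Union>\<P> = Y" and C: "0 < C"
    and PC: "\<And>w P x y. w \<in> lists A \<Longrightarrow> P \<in> \<P> \<Longrightarrow> x \<in> P \<Longrightarrow> y \<in> P \<Longrightarrow> dist (wmap w x) (wmap w y) \<le> C * r w"
    using pieces by blast
  define b where "b = real (card \<P>) * C powr t * K powr t"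
  have b: "0 \<le> b"
    by (simp add: b_def)
  have "(\<lambda>n. (C * K) * s ^ n) \<longlonglongrightarrow> (C * K) * 0" "(\<lambda>n. b * weight t W ^ n) \<longlonglongrightarrow> b * 0"
    using s W(5) weight_nonneg[of t W] by (intro tendsto_mult_left LIMSEQ_realpow_zero; simp)+
  then have "\<forall>\<^sub>F n in sequentially. (C * K) * s ^ n < \<delta>" "\<forall>\<^sub>F n in sequentially. b * weight t W ^ n < \<epsilon>"
    using \<delta> \<epsilon> by (auto dest: order_tendstoD(2))
  then have "\<forall>\<^sub>F n in sequentially. (C * K) * s ^ n < \<delta> \<and> b * weight t W ^ n < \<epsilon>"
    by (rule eventually_conj)
  then obtain n where n: "(C * K) * s ^ n < \<delta>" "b * weight t W ^ n < \<epsilon>"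
    unfolding eventually_sequentially by blast
  define V where "V = wpow W n"
  have V: "finite V" "V \<subseteq> lists A" "\<And>w. w \<in> V \<Longrightarrow> n \<le> length w"
    unfolding V_def using finite_wpow[OF W(1)] wpow_lists[OF W(2)] length_wpow[OF W(3)] by auto
  have Vd: "C * r w \<le> \<delta>" if w: "w \<in> V" for w
  proof -
    have "r w \<le> K * s ^ length w"
      using V w by (intro r_decay) auto
    also have "\<dots> \<le> K * s ^ n"
      using V(3)[OF w] s K_pos by (intro mult_left_mono power_decreasing) auto
    finally have "C * r w \<le> C * (K * s ^ n)"
      using C by (intro mult_left_mono) auto
    then show ?thesis
      using n by (simp add: mult.assoc)
  qed
  define f where "f p = wmap (fst p) ` snd p" for p
  have bd: "bounded (f p) \<and> diameter (f p) \<le> C * r (fst p)" if "p \<in> V \<times> \<P>" for p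
  proof -
    have w: "fst p \<in> lists A" "snd p \<in> \<P>"
      using that V by auto
    have d: "dist x y \<le> C * r (fst p)" if "x \<in> f p" "y \<in> f p" for x y
      using that PC[OF w] by (auto simp: f_def)
    then have "diameter (f p) \<le> C * r (fst p)"
      using C r_pos[OF w(1)] by (intro diameter_le) (auto simp: dist_norm)
    moreover have "bounded (f p)"
      unfolding bounded_two_points using d by blast
    ultimately show ?thesis
      by blast
  qed
  have "hausdorff_premeasure t \<delta> (limit_set \<phi> Y X) \<le> (\<Sum>U\<in>f ` (V \<times> \<P>). diam_gauge t U)"
  proof (rule hausdorff_premeasure_le_finite)
    show "limit_set \<phi> Y X \<subseteq> \<Union> (f ` (V \<times> \<P>))"
    proof
      fix z assume "z \<in> limit_set \<phi> Y X"
      then obtain x where x: "x \<in> X" "z = coding_map \<phi> Y x"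
        by (auto simp: limit_set_def)
      obtain l where l: "pref x l \<in> V"
        using covered_by_wpow[OF W(4) subshift_shift[OF X]] x unfolding V_def covered_by_def by blast
      have "z \<in> wmap (pref x l) ` Y"
        using coding_map_in_wmap subshift_subset[OF X] x by blast
      then obtain y where y: "y \<in> Y" "z = wmap (pref x l) y"
        by blast
      then obtain P where "P \<in> \<P>" "y \<in> P"
        using P by blast
      then show "z \<in> \<Union> (f ` (V \<times> \<P>))"
        using l y by (intro UN_I[of "(pref x l, P)"]) (auto simp: f_def)
    qed
    show "bounded U \<and> diameter U \<le> \<delta>" if "U \<in> f ` (V \<times> \<P>)" for U
    proof -
      from that obtain p where U: "U = f p" and p: "p \<in> V \<times> \<P>"
        by (rule imageE)
      then have "C * r (fst p) \<le> \<delta>"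
        by (intro Vd) (simp add: mem_Times_iff)
      then show ?thesis
        unfolding U using bd[OF p] by linarith
    qed
  qed (use V P \<delta> in auto)
  also have "\<dots> \<le> (\<Sum>p\<in>V \<times> \<P>. diam_gauge t (f p))"
    using sum_image_le[of "V \<times> \<P>" "diam_gauge t" f] V P by (simp add: o_def)
  also have "\<dots> \<le> (\<Sum>p\<in>V \<times> \<P>. ennreal (C powr t * r (fst p) powr t))"
  proof (rule sum_mono)
    fix p assume p: "p \<in> V \<times> \<P>"
    have "diameter (f p) powr t \<le> (C * r (fst p)) powr t"
      using bd[OF p] t by (intro powr_mono2) (auto simp: diameter_ge_0)
    also have "\<dots> = C powr t * r (fst p) powr t"
      using C r_pos[of "fst p"] p V by (subst powr_mult) auto
    finally show "diam_gauge t (f p) \<le> ennreal (C powr t * r (fst p) powr t)"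
      using t by (auto simp: diam_gauge_def intro: ennreal_leI)
  qed
  also have "\<dots> = ennreal (\<Sum>p\<in>V \<times> \<P>. C powr t * r (fst p) powr t)"
    by (rule sum_ennreal) simp
  also have "(\<Sum>p\<in>V \<times> \<P>. C powr t * r (fst p) powr t) = real (card \<P>) * C powr t * weight t V"
  proof -
    have "(\<Sum>p\<in>V \<times> \<P>. C powr t * r (fst p) powr t) = (\<Sum>w\<in>V. \<Sum>P\<in>\<P>. C powr t * r w powr t)"
      by (simp only: sum.cartesian_product split_def)
    also have "\<dots> = (\<Sum>w\<in>V. real (card \<P>) * C powr t * r w powr t)"
      by (simp add: mult.assoc)
    finally show ?thesis
      by (simp only: sum_distrib_left)
  qed
  also have "ennreal (real (card \<P>) * C powr t * weight t V) \<le> ennreal \<epsilon>"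
  proof (rule ennreal_leI)
    have "real (card \<P>) * C powr t * weight t V \<le> real (card \<P>) * C powr t * (r [] powr t * weight t W ^ n)"
      unfolding V_def using W t by (intro mult_left_mono weight_wpow_le) auto
    also have "\<dots> = b * weight t W ^ n"
      by (simp add: b_def r_Nil)
    finally show "real (card \<P>) * C powr t * weight t V \<le> \<epsilon>"
      using n by simp
  qed
  finally show "hausdorff_premeasure t \<delta> (limit_set \<phi> Y X) \<le> ennreal \<epsilon>" .
qed (use t in simp)

text \<open>The Moran cut at scale \<delta>: words whose weight reaches \<delta> or less for the
  first time. As \<open>r\<close> need not decrease along prefixes, all proper prefixes are
  tested.\<close>

definition stopped :: "real \<Rightarrow> 'e list set" where
  "stopped \<delta> = {w \<in> lists A. r w \<le> \<delta> \<and> (\<forall>u v. w = u @ v \<and> v \<noteq> [] \<longrightarrow> \<delta> < r u)}"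

lemma prefix_free_stopped: "prefix_free (stopped \<delta>)"
  unfolding prefix_free_def
proof (intro ballI allI impI)
  fix u v p q assume uv: "u \<in> stopped \<delta>" "v \<in> stopped \<delta>" "u @ p = v @ q"
  have no: False if "u \<in> stopped \<delta>" "v \<in> stopped \<delta>" "v = u @ z" "z \<noteq> []" for u v z
    using that by (auto simp: stopped_def)
  from uv(3) obtain z where "u = v @ z \<or> v = u @ z"
    by (auto simp: append_eq_append_conv2)
  then show "u = v"
    using no uv(1,2) by (metis append_Nil2)
qed

lemma Nil_notin_stopped: "\<delta> < 1 \<Longrightarrow> [] \<notin> stopped \<delta>"
  using K_ge_1 by (auto simp: stopped_def r_Nil)

lemma pref_stopped:
  assumes "\<omega> \<in> full_shift A" "0 < \<delta>"
  shows "\<exists>n. pref \<omega> n \<in> stopped \<delta>"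
proof -
  have "(\<lambda>n. K * s ^ n) \<longlonglongrightarrow> K * 0"
    using s by (intro tendsto_mult_left LIMSEQ_realpow_zero) auto
  then have "\<forall>\<^sub>F n in sequentially. K * s ^ n < \<delta>"
    using assms(2) by (auto dest: order_tendstoD(2))
  then obtain n0 where "K * s ^ n0 < \<delta>"
    unfolding eventually_sequentially by blast
  then have "r (pref \<omega> n0) \<le> \<delta>"
    using r_decay[OF pref_in_lists[OF assms(1)], of n0] by simp
  then obtain n where n: "r (pref \<omega> n) \<le> \<delta>" "\<And>i. i < n \<Longrightarrow> \<not> r (pref \<omega> i) \<le> \<delta>"
    using exists_least_iff[of "\<lambda>n. r (pref \<omega> n) \<le> \<delta>"] by blast
  have "\<delta> < r u" if "pref \<omega> n = u @ v" "v \<noteq> []" for u v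
  proof -
    have "length u < n"
      using arg_cong[OF that(1), of length] that(2) by (cases v) auto
    moreover from this have "u = pref \<omega> (length u)"
      using pref_add[of \<omega> "length u" "n - length u"] that(1) by simp
    ultimately show ?thesis
      using n(2)[of "length u"] by simp
  qed
  then have "pref \<omega> n \<in> stopped \<delta>"
    using n(1) assms(1) by (auto simp: stopped_def simp del: in_lists_conv_set)
  then show ?thesis ..
qed

definition letter_factor :: real where
  "letter_factor = 1 / K\<^sup>2 * Min ((\<lambda>e. r [e]) ` A)"

lemma letter_factor_pos: "0 < letter_factor"
  using finite_A A_nonempty K_ge_1 r_pos by (auto simp: letter_factor_def Min_gr_iff intro!: mult_pos_pos)

text \<open>Before the last letter e the weight exceeds \<delta>, and e costs at most the factor
  \<open>1 / K\<^sup>2 * r [e]\<close>. There is a last letter because \<open>r []\<close> is at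
  least 1.\<close>

lemma stopped_ge:
  assumes "w \<in> stopped \<delta>" "0 < \<delta>" "\<delta> < 1"
  shows "letter_factor * \<delta> \<le> r w"
proof -
  obtain u e where w: "w = u @ [e]"
    using assms Nil_notin_stopped by (cases w rule: rev_cases) auto
  then have ue: "u \<in> lists A" "[e] \<in> lists A" "\<delta> < r u"
    using assms(1) by (auto simp: stopped_def)
  have "letter_factor * \<delta> \<le> (1 / K\<^sup>2 * r [e]) * r u"
    unfolding letter_factor_def using finite_A ue assms(2) r_pos[OF ue(1)] r_pos[OF ue(2)] letter_factor_pos
    by (intro mult_mono mult_left_mono Min_le) auto
  also have "\<dots> \<le> r w"
    using r_append_ge[OF ue(1,2)] w by (simp add: ac_simps)
  finally show ?thesis .
qed

text \<open>A packing argument: each image that meets \<open>U\<close> contains a ball of radius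
  comparable to \<delta> centred near \<open>U\<close>, and the centres are separated because
  incomparable words have disjoint images of \<open>interior Y\<close>.\<close>

lemma stopped_meeting_card_bounded:
  obtains M :: nat where
    "\<And>\<delta> U. 0 < \<delta> \<Longrightarrow> \<delta> < 1 \<Longrightarrow> (\<And>x y. x \<in> U \<Longrightarrow> y \<in> U \<Longrightarrow> dist x y \<le> \<delta>) \<Longrightarrow>
      finite {w \<in> stopped \<delta>. wmap w ` Y \<inter> U \<noteq> {}} \<and> card {w \<in> stopped \<delta>. wmap w ` Y \<inter> U \<noteq> {}} \<le> M"
proof -
  define b where "b = \<kappa> * letter_factor"
  have b: "0 < b"
    using \<kappa>_pos letter_factor_pos by (simp add: b_def)
  \<comment> \<open>\<open>h + 1\<close>: at most \<delta> within \<open>U\<close>, and at most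
    \<open>\<delta> * h\<close> from the meeting point to the centre of the ball.\<close>
  obtain M :: nat where M: "\<And>(a :: 'v) Z \<delta>. 0 < \<delta> \<Longrightarrow> Z \<subseteq> cball a ((h + 1) * \<delta>) \<Longrightarrow>
      (\<And>x y. x \<in> Z \<Longrightarrow> y \<in> Z \<Longrightarrow> x \<noteq> y \<Longrightarrow> b * \<delta> \<le> dist x y) \<Longrightarrow> finite Z \<and> card Z \<le> M"
    using separated_sets_card_bounded[OF b] by blast
  show thesis
  proof (rule that)
    fix \<delta> :: real and U :: "'v set"
    assume \<delta>: "0 < \<delta>" "\<delta> < 1" and U: "\<And>x y. x \<in> U \<Longrightarrow> y \<in> U \<Longrightarrow> dist x y \<le> \<delta>"
    define V where "V = {w \<in> stopped \<delta>. wmap w ` Y \<inter> U \<noteq> {}}"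
    show "finite {w \<in> stopped \<delta>. wmap w ` Y \<inter> U \<noteq> {}} \<and> card {w \<in> stopped \<delta>. wmap w ` Y \<inter> U \<noteq> {}} \<le> M"
      unfolding V_def[symmetric]
    proof (cases "U = {}")
      case True
      then show "finite V \<and> card V \<le> M"
        by (simp add: V_def)
    next
      case False
      then obtain a where a: "a \<in> U"
        by blast
      have VA: "w \<in> lists A" "r w \<le> \<delta>" if "w \<in> V" for w
        using that by (auto simp: V_def stopped_def)
      have "\<exists>p. ball p c \<subseteq> Y \<and> dist a (wmap w p) \<le> (h + 1) * \<delta>" if w: "w \<in> V" for w
      proof -
        obtain x where x: "x \<in> Y" "wmap w x \<in> U"
          using w by (auto simp: V_def)
        obtain p where p: "closed_segment x p \<subseteq> Y" "dist x p = h" "ball p c \<subseteq> Y"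
          using center[OF x(1)] by blast
        have "dist (wmap w x) (wmap w p) \<le> r w * h"
          using wmap_segment[OF VA(1)[OF w] p(1)] p(2) by simp
        also have "\<dots> \<le> \<delta> * h"
          using VA(2)[OF w] h by (intro mult_right_mono) auto
        finally have "dist a (wmap w p) \<le> \<delta> + \<delta> * h"
          using U[OF a x(2)] dist_triangle[of a "wmap w p" "wmap w x"] by linarith
        then show ?thesis
          using p(3) by (intro exI[of _ p]) (simp add: algebra_simps)
      qed
      then have "\<forall>w\<in>V. \<exists>p. ball p c \<subseteq> Y \<and> dist a (wmap w p) \<le> (h + 1) * \<delta>"
        by blast
      from bchoice[OF this] obtain p where p: "\<forall>w\<in>V. ball (p w) c \<subseteq> Y \<and> dist a (wmap w (p w)) \<le> (h + 1) * \<delta>"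
        by blast
      define z where "z w = wmap w (p w)" for w
      have ball: "ball (z w) (b * \<delta>) \<subseteq> wmap w ` interior Y" if w: "w \<in> V" for w
      proof -
        have "letter_factor * \<delta> \<le> r w"
          using w \<delta> by (intro stopped_ge) (auto simp: V_def)
        then have "b * \<delta> \<le> \<kappa> * r w"
          using \<kappa>_pos by (simp add: b_def mult.assoc)
        then have "ball (z w) (b * \<delta>) \<subseteq> ball (z w) (\<kappa> * r w)"
          by (rule subset_ball)
        also have "\<dots> \<subseteq> wmap w ` ball (p w) c"
          unfolding z_def using p w VA(1) by (intro ball_subset_wmap_ball) auto
        also have "\<dots> \<subseteq> wmap w ` interior Y"
          using p w by (intro image_mono interior_maximal) auto
        finally show ?thesis .
      qed
      have sep: "b * \<delta> \<le> dist (z v) (z w)" if vw: "v \<in> V" "w \<in> V" "v \<noteq> w" for v w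
      proof (rule ccontr)
        assume "\<not> b * \<delta> \<le> dist (z v) (z w)"
        then have "z w \<in> ball (z v) (b * \<delta>)" "z w \<in> ball (z w) (b * \<delta>)"
          using b \<delta> by auto
        then have "z w \<in> wmap v ` interior Y \<inter> wmap w ` interior Y"
          using ball vw by blast
        moreover have "\<forall>p q. v @ p \<noteq> w @ q"
          using prefix_free_stopped[of \<delta>] vw unfolding prefix_free_def V_def by blast
        ultimately show False
          using wmap_interior_disjoint[OF VA(1)[OF vw(1)] VA(1)[OF vw(2)]] by blast
      qed
      have "inj_on z V"
      proof (rule inj_onI, rule ccontr)
        fix v w assume "v \<in> V" "w \<in> V" "z v = z w" "v \<noteq> w"
        then show False
          using sep[of v w] mult_pos_pos[OF b \<delta>(1)] by simp
      qed
      moreover have "finite (z ` V) \<and> card (z ` V) \<le> M"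
        by (rule M[OF \<delta>(1), of _ a]) (use p sep in \<open>auto simp: z_def\<close>)
      ultimately show "finite V \<and> card V \<le> M"
        by (simp add: finite_image_iff card_image)
    qed
  qed
qed

text \<open>Each set of an economical cover is replaced by the at most \<open>M\<close> stopped
  words, at the scale of its diameter, whose images meet it. Their cylinders are open, so
  compactness of \<open>X\<close> leaves finitely many even though the covering sets may fail to be
  open.\<close>

lemma cover_of_hausdorff_dim_less:
  assumes X: "subshift A X" and t: "0 < t" and dim: "hausdorff_dim (limit_set \<phi> Y X) < ennreal t"
  shows "\<exists>W. finite W \<and> W \<subseteq> lists A \<and> [] \<notin> W \<and> covered_by X W \<and> weight t W < 1"
proof -
  obtain M :: nat where M: "\<And>\<delta> U. 0 < \<delta> \<Longrightarrow> \<delta> < 1 \<Longrightarrow> (\<And>x y. x \<in> U \<Longrightarrow> y \<in> U \<Longrightarrow> dist x y \<le> \<delta>) \<Longrightarrow>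
      finite {w \<in> stopped \<delta>. wmap w ` Y \<inter> U \<noteq> {}} \<and> card {w \<in> stopped \<delta>. wmap w ` Y \<inter> U \<noteq> {}} \<le> M"
    using stopped_meeting_card_bounded by blast
  \<comment> \<open>The gauges and the padding by \<eta> contribute \<epsilon> each, multiplied by
    \<open>M\<close>; the added 1 covers \<open>M = 0\<close>.\<close>
  define \<epsilon> where "\<epsilon> = 1 / (4 * (real M + 1))"
  have \<epsilon>: "0 < \<epsilon>" "\<epsilon> < 1" "real M * (2 * \<epsilon>) < 1"
    by (auto simp: \<epsilon>_def divide_less_eq)
  \<comment> \<open>Diameters of at most \<open>1 / 2\<close> keep the scales below 1, so that
    stopped words are nonempty.\<close>
  obtain U where cover: "delta_cover (1 / 2) (limit_set \<phi> Y X) U" and sum: "(\<Sum>i. diam_gauge t (U i)) < ennreal \<epsilon>"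
    using hausdorff_dim_less_obtain_cover[OF dim \<epsilon>(1), of "1 / 2"] by auto
  have U: "bounded (U i)" "diameter (U i) \<le> 1 / 2" for i
    using cover by (auto simp: delta_cover_def)
  \<comment> \<open>A set of diameter 0 offers no scale to stop at; these positive substitutes have
    t-th powers that sum to \<epsilon>.\<close>
  define \<eta> where "\<eta> i = (\<epsilon> * (1 / 2) ^ Suc i) powr (1 / t)" for i
  have half: "0 < \<epsilon> * (1 / 2) ^ Suc i" "\<epsilon> * (1 / 2) ^ Suc i < 1" for i
  proof -
    have "\<epsilon> * (1 / 2) ^ Suc i \<le> \<epsilon> * 1"
      using \<epsilon> by (intro mult_left_mono power_le_one) auto
    then show "\<epsilon> * (1 / 2) ^ Suc i < 1"
      using \<epsilon> by linarith
  qed (use \<epsilon> in simp)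
  have \<eta>: "0 < \<eta> i" "\<eta> i < 1" "\<eta> i powr t = \<epsilon> * (1 / 2) ^ Suc i" for i
  proof -
    show "0 < \<eta> i"
      using \<epsilon>(1) by (simp add: \<eta>_def)
    show "\<eta> i < 1"
      using half[of i] t powr_less_mono2[of "1 / t" "\<epsilon> * (1 / 2) ^ Suc i" 1] by (simp add: \<eta>_def)
    have "\<eta> i powr t = (\<epsilon> * (1 / 2) ^ Suc i) powr 1"
      unfolding \<eta>_def powr_powr using t by simp
    also have "\<dots> = \<epsilon> * (1 / 2) ^ Suc i"
      by (rule powr_one[OF less_imp_le[OF half(1)]])
    finally show "\<eta> i powr t = \<epsilon> * (1 / 2) ^ Suc i" .
  qed
  define \<delta> where "\<delta> i = max (diameter (U i)) (\<eta> i)" for i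
  have \<delta>: "0 < \<delta> i" "\<delta> i < 1" for i
    using \<eta>[of i] U(2)[of i] by (auto simp: \<delta>_def)
  have \<delta>_powr: "\<delta> i powr t \<le> diameter (U i) powr t + \<epsilon> * (1 / 2) ^ Suc i" for i
  proof -
    have "\<delta> i = \<eta> i \<or> \<delta> i = diameter (U i)"
      by (auto simp: \<delta>_def max_def)
    then show ?thesis
      using \<eta>(3)[of i] half(1)[of i] powr_ge_zero[of "diameter (U i)" t]
      by (elim disjE ssubst) linarith+
  qed
  define V where "V i = {w \<in> stopped (\<delta> i). wmap w ` Y \<inter> U i \<noteq> {}}" for i
  have V: "finite (V i)" "card (V i) \<le> M" for i
  proof -
    have "dist x y \<le> \<delta> i" if "x \<in> U i" "y \<in> U i" for x y
      using diameter_bounded_bound[OF U(1) that] by (simp add: \<delta>_def)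
    then show "finite (V i)" "card (V i) \<le> M"
      using M[OF \<delta>, of "U i"] by (auto simp: V_def)
  qed
  have V_lists: "V i \<subseteq> lists A" and V_Nil: "[] \<notin> V i" for i
    using Nil_notin_stopped[OF \<delta>(2)] by (auto simp: V_def stopped_def)
  have V_weight: "weight t (V i) \<le> real M * (diameter (U i) powr t + \<epsilon> * (1 / 2) ^ Suc i)" for i
  proof -
    have "weight t (V i) \<le> (\<Sum>w\<in>V i. \<delta> i powr t)"
    proof (rule sum_mono)
      fix w assume w: "w \<in> V i"
      then show "r w powr t \<le> \<delta> i powr t"
        using r_pos[of w] V_lists[of i] t by (intro powr_mono2) (auto simp: V_def stopped_def)
    qed
    also have "\<dots> = real (card (V i)) * \<delta> i powr t"
      by simp
    also have "\<dots> \<le> real M * (diameter (U i) powr t + \<epsilon> * (1 / 2) ^ Suc i)"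
      using V(2)[of i] \<delta>_powr[of i] by (intro mult_mono) auto
    finally show ?thesis .
  qed
  define N where "N i = {x \<in> full_shift A. \<exists>n. pref x n \<in> V i}" for i
  have "compactin (seq_topology A) X"
    using X compact_space_seq_topology[OF finite_A] by (intro closedin_compact_space) (auto simp: subshift_def)
  moreover have "openin (seq_topology A) S" if "S \<in> range N" for S
    using that openin_prefix_in by (auto simp: N_def)
  moreover have "X \<subseteq> \<Union> (range N)"
  proof
    fix x assume x: "x \<in> X"
    then have full: "x \<in> full_shift A"
      using subshift_subset[OF X] by blast
    have "coding_map \<phi> Y x \<in> limit_set \<phi> Y X"
      using x by (simp add: limit_set_def)
    then obtain i where i: "coding_map \<phi> Y x \<in> U i"
      using cover by (auto simp: delta_cover_def)
    obtain n where "pref x n \<in> stopped (\<delta> i)"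
      using pref_stopped[OF full \<delta>(1)] by blast
    then have "pref x n \<in> V i"
      using coding_map_in_wmap[OF full, of n] i by (auto simp: V_def)
    then show "x \<in> \<Union> (range N)"
      using full by (auto simp: N_def)
  qed
  ultimately obtain \<F> where F: "finite \<F>" "\<F> \<subseteq> range N" "X \<subseteq> \<Union> \<F>"
    using compactinD by metis
  then obtain I where I: "finite I" "\<F> = N ` I"
    using finite_subset_image[of \<F> N UNIV] by auto
  define W where "W = (\<Union>i\<in>I. V i)"
  have "weight t W \<le> (\<Sum>p\<in>(SIGMA i:I. V i). r (snd p) powr t)"
    by (rule sum_le_sum_image_superset) (use I V in \<open>auto simp: W_def image_iff\<close>)
  also have "\<dots> = (\<Sum>i\<in>I. weight t (V i))"
    by (subst sum.Sigma) (use I V in \<open>auto simp: case_prod_beta\<close>)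
  also have "\<dots> \<le> (\<Sum>i\<in>I. real M * (diameter (U i) powr t + \<epsilon> * (1 / 2) ^ Suc i))"
    by (intro sum_mono V_weight)
  also have "\<dots> = real M * ((\<Sum>i\<in>I. diameter (U i) powr t) + \<epsilon> * (\<Sum>i\<in>I. (1 / 2) ^ Suc i))"
    by (simp only: sum_distrib_left[symmetric] sum.distrib)
  also have "\<dots> \<le> real M * (2 * \<epsilon>)"
  proof (rule mult_left_mono)
    have gauge: "diam_gauge t (U i) = ennreal (diameter (U i) powr t)" for i
      using t by (auto simp: diam_gauge_def)
    have "ennreal (\<Sum>i\<in>I. diameter (U i) powr t) = (\<Sum>i\<in>I. diam_gauge t (U i))"
      by (simp add: gauge sum_ennreal)
    also have "\<dots> \<le> (\<Sum>i. diam_gauge t (U i))"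
      by (rule sum_le_suminf) (use I in auto)
    also have "\<dots> < ennreal \<epsilon>"
      by (rule sum)
    finally have "(\<Sum>i\<in>I. diameter (U i) powr t) < \<epsilon>"
      by (simp add: ennreal_less_iff sum_nonneg)
    moreover have "(\<Sum>i\<in>I. (1 / 2) ^ Suc i) \<le> (1 :: real)"
      using sum_le_suminf[OF sums_summable[OF power_half_series] I(1)] sums_unique[OF power_half_series] by simp
    then have "\<epsilon> * (\<Sum>i\<in>I. (1 / 2) ^ Suc i) \<le> \<epsilon> * 1"
      using \<epsilon> by (intro mult_left_mono) auto
    ultimately show "(\<Sum>i\<in>I. diameter (U i) powr t) + \<epsilon> * (\<Sum>i\<in>I. (1 / 2) ^ Suc i) \<le> 2 * \<epsilon>"
      by linarith
  qed simp
  finally have "weight t W < 1"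
    using \<epsilon> by linarith
  moreover have "covered_by X W"
    unfolding covered_by_def
  proof
    fix x assume "x \<in> X"
    then obtain i where "i \<in> I" "x \<in> N i"
      using F(3) unfolding I(2) by blast
    then show "\<exists>n. pref x n \<in> W"
      unfolding N_def W_def by blast
  qed
  moreover have "finite W" "W \<subseteq> lists A" "[] \<notin> W"
    using I(1) V(1) V_lists V_Nil unfolding W_def by blast+
  ultimately show ?thesis
    by blast
qed

theorem limit_set_dimension_spectrum:
  "{hausdorff_dim (limit_set \<phi> Y X) |X. subshift A X} = {0..hausdorff_dim (limit_set \<phi> Y (full_shift A))}"
proof -
  obtain idx where "bij_betw idx A {..<card A}"
    using ex_bij_betw_finite_nat[OF finite_A] by (auto simp: atLeast0LessThan)
  then interpret subshift_dimension A r K "1 / K\<^sup>2" s "\<lambda>X. hausdorff_dim (limit_set \<phi> Y X)" idx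
    by unfold_locales
      (auto simp: hausdorff_dim_empty limit_set_def intro: hausdorff_dim_mono
        cover_of_hausdorff_dim_less[unfolded limit_set_def] hausdorff_dim_le_of_cover[unfolded limit_set_def])
  show ?thesis
    by (rule dimension_spectrum)
qed

end

section \<open>Conformal iterated function systems\<close>

lemma (in cifs) center_of_cone:
  "\<exists>h>0. \<exists>c>0. \<forall>x\<in>Y. \<exists>p. closed_segment x p \<subseteq> Y \<and> dist x p = h \<and> ball p c \<subseteq> Y"
proof -
  obtain \<gamma> l where \<gamma>: "0 < \<gamma>" "\<gamma> < pi / 2" and l: "0 < l"
    and cone: "\<And>x. x \<in> Y \<Longrightarrow> \<exists>u. norm u = 1 \<and> open_cone x u \<gamma> l \<subseteq> interior Y"
    using cone_property by blast
  have cos: "0 < cos \<gamma>" "cos \<gamma> < 1"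
    using \<gamma> cos_gt_zero[of \<gamma>] cos_monotone_0_pi[of 0 \<gamma>] by auto
  define h where "h = l / 2"
  \<comment> \<open>The solution of \<open>cos \<gamma> * (h + c) = h - c\<close>: a point of the
    ball is at most \<open>h + c\<close> away from the vertex and more than \<open>h - c\<close>
    along the axis. As \<open>c \<le> h\<close>, it stays below the altitude
    \<open>2 * h\<close>.\<close>
  define c where "c = h * (1 - cos \<gamma>) / (1 + cos \<gamma>)"
  have h: "0 < h"
    using l by (simp add: h_def)
  have c: "0 < c"
    using h cos by (simp add: c_def)
  have "(1 - cos \<gamma>) / (1 + cos \<gamma>) \<le> 1"
    using cos by simp
  then have ch: "c \<le> h"
    using h mult_left_mono[of "(1 - cos \<gamma>) / (1 + cos \<gamma>)" 1 h] by (simp add: c_def)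
  have "c * (1 + cos \<gamma>) = h * (1 - cos \<gamma>)"
    using cos by (simp add: c_def)
  then have angle: "cos \<gamma> * (h + c) = h - c"
    by (simp add: algebra_simps)
  show ?thesis
  proof (rule exI[of _ h], intro conjI, rule h, rule exI[of _ c], intro conjI, rule c, intro ballI)
    fix x assume x: "x \<in> Y"
    then obtain u where u: "norm u = 1" "open_cone x u \<gamma> l \<subseteq> interior Y"
      using cone by blast
    then have uu: "u \<bullet> u = 1"
      by (simp add: norm_eq_1)
    have sub: "open_cone x u \<gamma> l \<subseteq> Y"
      using u interior_subset by blast
    define p where "p = x + h *\<^sub>R u"
    have "closed_segment x p \<subseteq> Y"
    proof
      fix y assume "y \<in> closed_segment x p"
      then obtain t where t: "0 \<le> t" "t \<le> 1" "y = (1 - t) *\<^sub>R x + t *\<^sub>R p"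
        by (auto simp: in_segment)
      then have y: "y - x = (t * h) *\<^sub>R u"
        by (simp add: p_def algebra_simps)
      show "y \<in> Y"
      proof (cases "t = 0")
        case True
        then show ?thesis
          using t x by simp
      next
        case False
        then have th: "0 < t * h" "t * h \<le> 1 * h"
          using t h by (auto intro: mult_right_mono)
        have "cos \<gamma> * (t * h) < 1 * (t * h)"
          using th cos by (intro mult_strict_right_mono) auto
        then have "y \<in> open_cone x u \<gamma> l"
          using th l u(1) uu y by (simp add: open_cone_def h_def)
        then show ?thesis
          using sub by blast
      qed
    qed
    moreover have "dist x p = h"
      using h u(1) by (simp add: p_def dist_norm)
    moreover have "ball p c \<subseteq> Y"
    proof
      fix y assume y: "y \<in> ball p c"
      define v where "v = y - p"
      have v: "norm v < c" "y - x = h *\<^sub>R u + v"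
        using y by (auto simp: v_def p_def dist_norm norm_minus_commute)
      have "\<bar>v \<bullet> u\<bar> < c"
        using Cauchy_Schwarz_ineq2[of v u] u(1) v(1) by simp
      then have inner: "h - c < (y - x) \<bullet> u" "(y - x) \<bullet> u < h + c"
        using v uu by (auto simp: inner_add_left)
      have "norm (y - x) \<le> h + c"
        using v h u(1) norm_triangle_ineq[of "h *\<^sub>R u" v] by simp
      then have "cos \<gamma> * norm (y - x) \<le> cos \<gamma> * (h + c)"
        using cos by (intro mult_left_mono) auto
      then have "y \<in> open_cone x u \<gamma> l"
        using angle inner ch by (auto simp: open_cone_def h_def)
      then show "y \<in> Y"
        using sub by blast
    qed
    ultimately show "\<exists>p. closed_segment x p \<subseteq> Y \<and> dist x p = h \<and> ball p c \<subseteq> Y"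
      by blast
  qed
qed

text \<open>The additive Hoelder condition becomes multiplicative because the inverse of the
  supremum of \<open>1 / \<rho> e z\<close> is at most \<open>\<rho> e y\<close>. This needs a
  bounded supremum, which continuity of the derivative on the compact \<open>Y\<close>
  provides.\<close>

lemma (in cifs) scaled_ifs_exists:
  assumes fin: "finite A"
  shows "\<exists>\<rho> L \<alpha> s h c. scaled_ifs A Y \<phi> \<rho> L \<alpha> s h c"
proof -
  obtain W \<psi> L \<alpha> where W_all: "\<forall>e\<in>A. open (W e) \<and> Topological_Spaces.connected (W e) \<and> Y \<subseteq> W e \<and>
        (\<forall>x\<in>Y. \<psi> e x = \<phi> e x) \<and> C1_conformal_diffeo_into (W e) (\<Inter>f\<in>A. W f) (\<psi> e)"
    and L: "1 \<le> L" and \<alpha>: "0 < \<alpha>" and hoelder_all: "\<forall>e\<in>A. \<forall>x\<in>Y. \<forall>y\<in>Y.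
        \<bar>onorm (frechet_derivative (\<psi> e) (at x)) - onorm (frechet_derivative (\<psi> e) (at y))\<bar>
        \<le> L * inverse (SUP z\<in>Y. onorm (inv (frechet_derivative (\<psi> e) (at z)))) * norm (x - y) powr \<alpha>"
    using conformal_extension by (elim exE conjE) (rule that; assumption)
  have W: "open (W e) \<and> Y \<subseteq> W e \<and> (\<forall>x\<in>Y. \<psi> e x = \<phi> e x) \<and>
      C1_conformal_diffeo_into (W e) (\<Inter>f\<in>A. W f) (\<psi> e)" if "e \<in> A" for e
    using W_all that by simp
  note hoelder = hoelder_all[rule_format]
  define \<rho> where "\<rho> e x = onorm (frechet_derivative (\<psi> e) (at x))" for e x
  have der: "0 < \<rho> e x \<and> (\<exists>T. orthogonal_transformation T \<and> (\<psi> e has_derivative (\<lambda>v. \<rho> e x *\<^sub>R T v)) (at x))"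
    and inv_der: "onorm (inv (frechet_derivative (\<psi> e) (at x))) = 1 / \<rho> e x"
    if e: "e \<in> A" and x: "x \<in> W e" for e x
  proof -
    have "conformal_on (W e) (\<psi> e)"
      using W[OF e] by (simp add: C1_conformal_diffeo_into_def)
    then obtain k T where k: "0 < k" and T: "orthogonal_transformation T"
      and d: "(\<psi> e has_derivative (\<lambda>v. k *\<^sub>R T v)) (at x)"
      using x unfolding conformal_on_def by blast
    have fd: "frechet_derivative (\<psi> e) (at x) = (\<lambda>v. k *\<^sub>R T v)"
      using frechet_derivative_at[OF d] by simp
    have \<rho>: "\<rho> e x = k"
      using onorm_similarity[OF T, of k] k by (simp add: \<rho>_def fd)
    show "0 < \<rho> e x \<and> (\<exists>T. orthogonal_transformation T \<and> (\<psi> e has_derivative (\<lambda>v. \<rho> e x *\<^sub>R T v)) (at x))"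
      unfolding \<rho> using k T d by blast
    have "inv (frechet_derivative (\<psi> e) (at x)) = (\<lambda>v. (1 / k) *\<^sub>R inv T v)"
      unfolding fd using T k by (intro inv_similarity) auto
    then show "onorm (inv (frechet_derivative (\<psi> e) (at x))) = 1 / \<rho> e x"
      using onorm_similarity[OF orthogonal_transformation_inv[OF T], of "1 / k"] k by (simp add: \<rho>)
  qed
  have cont: "continuous_on Y (\<rho> e)" if e: "e \<in> A" for e
  proof -
    have "C1_on (W e) (\<psi> e)" and YW: "Y \<subseteq> W e"
      using W[OF e] by (simp_all add: C1_conformal_diffeo_into_def)
    then obtain f' where f': "\<forall>x\<in>W e. (\<psi> e has_derivative blinfun_apply (f' x)) (at x)"
      and contf': "continuous_on (W e) f'"
      unfolding C1_on_def by (elim exE conjE)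
    have "\<rho> e x = norm (f' x)" if "x \<in> Y" for x
      using frechet_derivative_at[OF bspec[OF f' subsetD[OF YW that]]]
      by (simp add: \<rho>_def norm_blinfun.rep_eq)
    moreover have "continuous_on Y (\<lambda>x. norm (f' x))"
      by (intro continuous_on_norm continuous_on_subset[OF contf' YW])
    ultimately show ?thesis
      by (simp cong: continuous_on_cong)
  qed
  have holder': "\<rho> e x \<le> \<rho> e y * (1 + L * dist x y powr \<alpha>)" if e: "e \<in> A" and xy: "x \<in> Y" "y \<in> Y" for e x y
  proof -
    have pos: "0 < \<rho> e z" if "z \<in> Y" for z
      using der[OF e] W[OF e] that by blast
    obtain z0 where z0: "z0 \<in> Y" "\<And>z. z \<in> Y \<Longrightarrow> \<rho> e z0 \<le> \<rho> e z"
      using continuous_attains_inf[OF compact nonempty cont[OF e]] by blast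
    define S where "S = (SUP z\<in>Y. onorm (inv (frechet_derivative (\<psi> e) (at z))))"
    have S: "S = (SUP z\<in>Y. 1 / \<rho> e z)"
      unfolding S_def using inv_der[OF e] W[OF e] by (intro SUP_cong) auto
    have "bdd_above ((\<lambda>z. 1 / \<rho> e z) ` Y)"
      using z0 pos by (intro bdd_aboveI2[of _ _ "1 / \<rho> e z0"]) (simp add: frac_le)
    then have "1 / \<rho> e y \<le> S"
      unfolding S using xy(2) by (intro cSUP_upper2[of _ _ y]) auto
    then have "inverse S \<le> inverse (1 / \<rho> e y)"
      using pos[OF xy(2)] by (intro le_imp_inverse_le) auto
    then have "L * inverse S * norm (x - y) powr \<alpha> \<le> L * \<rho> e y * dist x y powr \<alpha>"
      using L unfolding dist_norm by (intro mult_right_mono mult_left_mono) auto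
    moreover have "\<rho> e x - \<rho> e y \<le> L * inverse S * norm (x - y) powr \<alpha>"
      using hoelder[OF e xy] by (simp add: \<rho>_def S_def)
    ultimately show ?thesis
      by (simp add: algebra_simps)
  qed
  obtain s where s: "0 < s" "s < 1" "\<And>e. e \<in> A \<Longrightarrow> s-lipschitz_on Y (\<phi> e)"
    using contraction by blast
  obtain h c where hc: "0 < h" "0 < c"
    "\<And>x. x \<in> Y \<Longrightarrow> \<exists>p. closed_segment x p \<subseteq> Y \<and> dist x p = h \<and> ball p c \<subseteq> Y"
    using center_of_cone by blast
  have "scaled_ifs A Y \<phi> \<rho> L \<alpha> s h c"
  proof
    show "A \<noteq> {}"
      using two_letters by blast
    show "0 \<le> L"
      using L by simp
    fix e x assume e: "e \<in> A" and x: "x \<in> Y"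
    then have xW: "x \<in> W e"
      using W by blast
    then show "0 < \<rho> e x"
      using der[OF e] by blast
    obtain T where T: "orthogonal_transformation T" "(\<psi> e has_derivative (\<lambda>v. \<rho> e x *\<^sub>R T v)) (at x)"
      using der[OF e xW] by blast
    \<comment> \<open>The extension agrees with \<open>\<phi> e\<close> only on \<open>Y\<close>, so
      its derivative is transferred as a derivative within \<open>Y\<close>.\<close>
    have "(\<phi> e has_derivative (\<lambda>v. \<rho> e x *\<^sub>R T v)) (at x within Y)"
      by (rule has_derivative_transform[OF x _ has_derivative_at_withinI[OF T(2)]]) (use W[OF e] in auto)
    then show "\<exists>T. orthogonal_transformation T \<and> (\<phi> e has_derivative (\<lambda>v. \<rho> e x *\<^sub>R T v)) (at x within Y)"
      using T(1) by blast
  qed (use fin compact nonempty maps_to injective open_set_condition s \<alpha> hc holder' in auto)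
  then show ?thesis
    by blast
qed

theorem theorem3p3:
  fixes A :: "'e set" and Y :: "(real ^ 'd) set" and \<phi> :: "'e \<Rightarrow> real ^ 'd \<Rightarrow> real ^ 'd"
  assumes "finite A" and "card A \<ge> 2"
    and "cifs A Y \<phi>"
  shows "{hausdorff_dim (limit_set \<phi> Y X) |X. subshift A X}
       = {0..hausdorff_dim (limit_set \<phi> Y (full_shift A))}"
proof -
  obtain \<rho> L \<alpha> s h c where "scaled_ifs A Y \<phi> \<rho> L \<alpha> s h c"
    using cifs.scaled_ifs_exists[OF assms(3,1)] by blast
  then show ?thesis
    by (rule scaled_ifs.limit_set_dimension_spectrum)
qed

end
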